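(* There exists a CB generated hyperbolic Polish group $G$ and a point $\xi$ on the Gromov boundary of $G$ such that the stabiliser of $\xi$ in $G$ is not amenable.
   Context: A Polish group is a topological group whose topology is separable and completely metrisable. A subset $A$ of a Polish group $G$ is coarsely bounded (CB) if it has finite diameter for every continuous left-invariant pseudo-metric on $G$. $G$ is CB generated if it is generated by a coarsely bounded subset. Such a group has a word metric, associated to a closed symmetric coarsely bounded generating set, which is canonical up to quasi-isometry. $G$ is hyperbolic if it is Gromov-hyperbolic for such a word metric (equivalently, the corresponding Cayley graph is Gromov-hyperbolic); the Gromov boundary of $G$ is that of $G$ with this word metric, and $G$ acts on it through the action of $G$ on itself by left translations. A topological group $H$ is amenable if every continuous action of $H$ on a (non-empty, Hausdorff) compact space admits an $H$-invariant Borel (regular) probability measure. The stabiliser of $\xi$ carries the subspace topology from $G$. *)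

theory Defs
  imports
    "HOL-Analysis.Analysis"
    "HOL-Probability.Probability_Measure"
    "HOL-Algebra.Generated_Groups"
    "HOL-Algebra.Group_Action"
begin

locale topological_group = group G for G :: "('g, 'b) monoid_scheme" (structure) +
  fixes T :: "'g topology"
  assumes topspace_eq: "topspace T = carrier G"
    and continuous_mult: "continuous_map (prod_topology T T) T (\<lambda>(x, y). x \<otimes> y)"
    and continuous_inv: "continuous_map T T (\<lambda>x. inv x)"

(* A Polish group has at most continuum many elements, so every Polish group is isomorphic
   to one whose carrier is a subset of the type nat \<Rightarrow> nat. *)
locale Polish_group = topological_group +
  assumes separable: "separable_space T"
    and completely_metrizable: "completely_metrizable_space T"

definition continuous_left_invariant_pseudometric ::
  "('g, 'b) monoid_scheme \<Rightarrow> 'g topology \<Rightarrow> ('g \<Rightarrow> 'g \<Rightarrow> real) \<Rightarrow> bool" where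
  "continuous_left_invariant_pseudometric G T d \<longleftrightarrow>
     (\<forall>x\<in>carrier G. \<forall>y\<in>carrier G. 0 \<le> d x y \<and> d x y = d y x) \<and>
     (\<forall>x\<in>carrier G. d x x = 0) \<and>
     (\<forall>x\<in>carrier G. \<forall>y\<in>carrier G. \<forall>z\<in>carrier G. d x z \<le> d x y + d y z) \<and>
     (\<forall>g\<in>carrier G. \<forall>x\<in>carrier G. \<forall>y\<in>carrier G. d (g \<otimes>\<^bsub>G\<^esub> x) (g \<otimes>\<^bsub>G\<^esub> y) = d x y) \<and>
     continuous_map (prod_topology T T) euclideanreal (\<lambda>(x, y). d x y)"

definition coarsely_bounded ::
  "('g, 'b) monoid_scheme \<Rightarrow> 'g topology \<Rightarrow> 'g set \<Rightarrow> bool" where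
  "coarsely_bounded G T A \<longleftrightarrow>
     A \<subseteq> carrier G \<and>
     (\<forall>d. continuous_left_invariant_pseudometric G T d \<longrightarrow>
        (\<exists>C. \<forall>x\<in>A. \<forall>y\<in>A. d x y \<le> C))"

definition CB_generated :: "('g, 'b) monoid_scheme \<Rightarrow> 'g topology \<Rightarrow> bool" where
  "CB_generated G T \<longleftrightarrow> (\<exists>S. coarsely_bounded G T S \<and> generate G S = carrier G)"

definition word_generating_set ::
  "('g, 'b) monoid_scheme \<Rightarrow> 'g topology \<Rightarrow> 'g set \<Rightarrow> bool" where
  "word_generating_set G T S \<longleftrightarrow>
     closedin T S \<and> (\<forall>s\<in>S. inv\<^bsub>G\<^esub> s \<in> S) \<and> coarsely_bounded G T S \<and>
     generate G S = carrier G"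

(* Inverses of letters are not needed because S will be symmetric. *)
definition word_length :: "('g, 'b) monoid_scheme \<Rightarrow> 'g set \<Rightarrow> 'g \<Rightarrow> nat" where
  "word_length G S g =
     (LEAST n. \<exists>ws. length ws = n \<and> set ws \<subseteq> S \<and> foldr (\<otimes>\<^bsub>G\<^esub>) ws \<one>\<^bsub>G\<^esub> = g)"

definition word_dist :: "('g, 'b) monoid_scheme \<Rightarrow> 'g set \<Rightarrow> 'g \<Rightarrow> 'g \<Rightarrow> real" where
  "word_dist G S x y = real (word_length G S (inv\<^bsub>G\<^esub> x \<otimes>\<^bsub>G\<^esub> y))"

definition gromov_product :: "('a \<Rightarrow> 'a \<Rightarrow> real) \<Rightarrow> 'a \<Rightarrow> 'a \<Rightarrow> 'a \<Rightarrow> real" where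
  "gromov_product d e x y = (d e x + d e y - d x y) / 2"

definition Gromov_hyperbolic :: "'a set \<Rightarrow> ('a \<Rightarrow> 'a \<Rightarrow> real) \<Rightarrow> bool" where
  "Gromov_hyperbolic M d \<longleftrightarrow>
     (\<exists>\<delta>. \<forall>e\<in>M. \<forall>x\<in>M. \<forall>y\<in>M. \<forall>z\<in>M.
        gromov_product d e x z \<ge> min (gromov_product d e x y) (gromov_product d e y z) - \<delta>)"

(* The sequential boundary: the spaces considered are in general neither geodesic nor
   proper. In a hyperbolic metric space the notions below do not depend on the base point
   e, and the relation is an equivalence relation on the Gromov sequences. *)
definition gromov_sequences :: "'a set \<Rightarrow> ('a \<Rightarrow> 'a \<Rightarrow> real) \<Rightarrow> 'a \<Rightarrow> (nat \<Rightarrow> 'a) set" where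
  "gromov_sequences M d e =
     {x. range x \<subseteq> M \<and>
         filterlim (\<lambda>(i, j). gromov_product d e (x i) (x j)) at_top
           (sequentially \<times>\<^sub>F sequentially)}"

definition gromov_rel ::
  "'a set \<Rightarrow> ('a \<Rightarrow> 'a \<Rightarrow> real) \<Rightarrow> 'a \<Rightarrow> ((nat \<Rightarrow> 'a) \<times> (nat \<Rightarrow> 'a)) set" where
  "gromov_rel M d e =
     {(x, y). x \<in> gromov_sequences M d e \<and> y \<in> gromov_sequences M d e \<and>
        filterlim (\<lambda>(i, j). gromov_product d e (x i) (y j)) at_top
          (sequentially \<times>\<^sub>F sequentially)}"

definition gromov_boundary ::
  "'a set \<Rightarrow> ('a \<Rightarrow> 'a \<Rightarrow> real) \<Rightarrow> 'a \<Rightarrow> (nat \<Rightarrow> 'a) set set" where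
  "gromov_boundary M d e = gromov_sequences M d e // gromov_rel M d e"

(* A boundary point is a class of sequences; g sends the class of x to the class of
   i \<mapsto> g x(i), which is the image of the class since left translation by g is a
   bijective isometry. *)
definition boundary_action ::
  "('g, 'b) monoid_scheme \<Rightarrow> 'g \<Rightarrow> (nat \<Rightarrow> 'g) set \<Rightarrow> (nat \<Rightarrow> 'g) set" where
  "boundary_action G g \<xi> = (\<lambda>x i. g \<otimes>\<^bsub>G\<^esub> x i) ` \<xi>"

definition regular_borel_prob :: "'x topology \<Rightarrow> 'x measure \<Rightarrow> bool" where
  "regular_borel_prob X M \<longleftrightarrow>
     sets M = sets (sigma (topspace X) {U. openin X U}) \<and> prob_space M \<and>
     (\<forall>A\<in>sets M.
        emeasure M A = (SUP K\<in>{K. compactin X K \<and> K \<subseteq> A}. emeasure M K) \<and>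
        emeasure M A = (INF U\<in>{U. openin X U \<and> A \<subseteq> U}. emeasure M U))"

definition continuous_action ::
  "('g, 'b) monoid_scheme \<Rightarrow> 'g topology \<Rightarrow> 'x topology \<Rightarrow> ('g \<Rightarrow> 'x \<Rightarrow> 'x) \<Rightarrow> bool" where
  "continuous_action H T X \<phi> \<longleftrightarrow>
     group_action H (topspace X) \<phi> \<and>
     continuous_map (prod_topology T X) X (\<lambda>(g, x). \<phi> g x)"

(* HOL cannot quantify over all types of points of X, but 'g set set loses nothing: if H
   acts on a compact Hausdorff X, the closure of an orbit is a non-empty closed invariant
   subspace, and it suffices to find an invariant measure there. It has a dense subset D
   with |D| \<le> |'g|, and a point of a Hausdorff space is determined by the traces on D of
   its neighbourhoods, so the closure has at most |'g set set| points. *)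
definition amenable :: "('g, 'b) monoid_scheme \<Rightarrow> 'g topology \<Rightarrow> bool" where
  "amenable H T \<longleftrightarrow>
     (\<forall>(X :: 'g set set topology) \<phi>.
        compact_space X \<and> Hausdorff_space X \<and> topspace X \<noteq> {} \<and> continuous_action H T X \<phi> \<longrightarrow>
        (\<exists>M. regular_borel_prob X M \<and> (\<forall>g\<in>carrier H. distr M M (\<phi> g) = M)))"

end

theory Submission
  imports Defs
begin

text \<open>The example is \<open>G = \<int> \<times> (F wr Sym(\<nat>))\<close>, where \<open>F\<close> is a countable group of homeomorphisms of a compact
Hausdorff space \<open>X\<close> that preserves no Borel probability measure, and the wreath product is the
unrestricted one, the semidirect product of the full power \<open>F\<^sup>\<nat>\<close> and \<open>Sym(\<nat>)\<close>, with the topology of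
pointwise convergence.

The group \<open>K = F wr Sym(\<nat>)\<close> is coarsely bounded although \<open>F\<close> need not be. Every neighbourhood of the
identity contains, for some \<open>n\<close>, the subgroup of the elements that are trivial on the first \<open>n\<close>
coordinates. By exchanging these coordinates with others one writes every element of \<open>K\<close> as a
product, of bounded length, of elements of this subgroup and copies of one fixed permutation
(\<open>wreath_product_bounded\<close>).
So \<open>K\<close> is invisible for the coarse geometry, and the word metric of \<open>G\<close> for the generating set
\<open>{-1, 0, 1} \<times> K\<close> is at bounded distance from the metric pulled back from \<open>\<int>\<close>
(\<open>word_length_approx\<close>). Hence \<open>G\<close> is hyperbolic, and its boundary points are the two ends of the
line. As \<open>G\<close> acts on \<open>\<int>\<close> by translations, it fixes both ends, so that the stabiliser of the
upper end is all of \<open>G\<close> (\<open>stabilizer_upper_end\<close>).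

On the other hand \<open>G\<close> is not amenable. It acts continuously on the compact space \<open>X\<^sup>\<nat>\<close>, and an
invariant measure there would have a coordinate marginal on \<open>X\<close> that is invariant under a copy of
\<open>F\<close> in one coordinate of the base group (\<open>not_amenable\<close>).

For \<open>X\<close> the Cantor space of binary sequences is taken, and for \<open>F\<close> the group generated by three
involutions. Two of them exchange the cylinder of the sequences that start with 0 with those of
the words 10 and 11, which forces an invariant probability to give it mass 1/3; the third flips
the first digit, which forces the mass 1/2 (\<open>no_invariant_probability_cantor\<close>).

To obtain the Polish topology cheaply, \<open>G\<close> is realised as a centralizer in \<open>Sym(\<nat>)\<close>
(\<open>Polish_group_sym_centralizer\<close>): \<open>\<nat>\<close> is identified with the disjoint union of a line \<open>\<int>\<close> and of
\<open>\<nat> \<times> F\<close>, and \<open>G\<close> is the group of permutations that commute with the unit shift of the line and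
with the left multiplications of \<open>F\<close> on \<open>\<nat> \<times> F\<close>.\<close>

section \<open>Locally constant maps on sequence spaces\<close>

lemma open_agreeing_below:
  fixes x :: "nat \<Rightarrow> 'a::discrete_topology"
  shows "open {y. \<forall>i<N. y i = x i}"
proof -
  have "open ((\<lambda>y::nat \<Rightarrow> 'a. y i) -` {x i})" for i
    by (intro open_vimage open_discrete continuous_on_product_coordinates)
  then have "open (\<Inter>i\<in>{..<N}. (\<lambda>y::nat \<Rightarrow> 'a. y i) -` {x i})"
    by (intro open_INT) auto
  moreover have "(\<Inter>i\<in>{..<N}. (\<lambda>y::nat \<Rightarrow> 'a. y i) -` {x i}) = {y. \<forall>i<N. y i = x i}"
    by auto
  ultimately show ?thesis by simp
qed

lemma open_contains_agreeing_below:
  fixes U :: "(nat \<Rightarrow> 'a::topological_space) set"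
  assumes "open U" "x \<in> U"
  shows "\<exists>N. \<forall>y. (\<forall>i<N. y i = x i) \<longrightarrow> y \<in> U"
proof -
  obtain X where X: "\<And>i. open (X i)" "finite {i. X i \<noteq> UNIV}" "x \<in> Pi\<^sub>E UNIV X" "Pi\<^sub>E UNIV X \<subseteq> U"
    using product_topology_open_contains_basis[of "\<lambda>_. euclidean" UNIV U x] assms
    by (auto simp: open_fun_def)
  obtain N where N: "\<And>i. X i \<noteq> UNIV \<Longrightarrow> i < N"
    using X(2) finite_nat_set_iff_bounded by auto
  have "y \<in> U" if "\<forall>i<N. y i = x i" for y
    using X(3,4) N that by (metis PiE_UNIV_domain PiE_iff Pi_I UNIV_I subsetD)
  then show ?thesis by blast
qed

text \<open>The product topology on sequences of points of a discrete space says that nearby sequences agree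
on an initial segment. All continuity proofs for permutation groups below reduce to this: each
coordinate of the result depends on finitely many coordinates of the arguments.\<close>

lemma eventually_agreeing_below:
  fixes x :: "nat \<Rightarrow> 'a::discrete_topology"
  shows "\<forall>\<^sub>F y in nhds x. \<forall>i<N. y i = x i"
  using open_agreeing_below[of N x] by (auto simp: eventually_nhds)

lemma eventually_eq_coordinate:
  fixes x :: "nat \<Rightarrow> 'a::discrete_topology"
  shows "\<forall>\<^sub>F y in nhds x. y i = x i"
  using eventually_agreeing_below[of "Suc i" x] by (auto elim: eventually_mono)

lemma continuous_on_locally_constant:
  assumes "\<And>x. x \<in> A \<Longrightarrow> \<forall>\<^sub>F y in nhds x. y \<in> A \<longrightarrow> f y = f x"
  shows "continuous_on A f"
  unfolding continuous_on_def
proof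
  fix x assume "x \<in> A"
  then have "\<forall>\<^sub>F y in at x within A. f y = f x"
    using assms[of x] by (simp add: eventually_at_filter eventually_mono)
  then show "(f \<longlongrightarrow> f x) (at x within A)"
    by (rule tendsto_eventually)
qed

lemma second_countable_euclidean:
  "second_countable (euclidean :: 'a::second_countable_topology topology)"
proof -
  obtain B :: "'a set set" where "countable B" "topological_basis B"
    using ex_countable_basis by blast
  then show ?thesis
    unfolding second_countable_def
    by (metis open_openin topological_basisE topological_basis_open)
qed


section \<open>Centralizers in the symmetric group of the natural numbers\<close>

definition sym_centralizer :: "(nat \<Rightarrow> nat) set \<Rightarrow> (nat \<Rightarrow> nat) monoid" where
  "sym_centralizer R = \<lparr>carrier = {g. bij g \<and> (\<forall>r\<in>R. g \<circ> r = r \<circ> g)}, mult = (\<circ>), one = id\<rparr>"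

definition pointwise_topology :: "(nat \<Rightarrow> nat) monoid \<Rightarrow> (nat \<Rightarrow> nat) topology" where
  "pointwise_topology G = top_of_set (carrier G)"

lemma sym_centralizer_simps [simp]:
  "g \<otimes>\<^bsub>sym_centralizer R\<^esub> h = g \<circ> h" "\<one>\<^bsub>sym_centralizer R\<^esub> = id"
  by (simp_all add: sym_centralizer_def)

lemma in_sym_centralizer:
  "g \<in> carrier (sym_centralizer R) \<longleftrightarrow> bij g \<and> (\<forall>r\<in>R. g \<circ> r = r \<circ> g)"
  by (simp add: sym_centralizer_def)

lemma sym_centralizer_inv_closed:
  assumes "g \<in> carrier (sym_centralizer R)"
  shows "inv_into UNIV g \<in> carrier (sym_centralizer R)"
proof -
  have "bij g" and c: "\<And>r w. r \<in> R \<Longrightarrow> g (r w) = r (g w)"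
    using assms by (auto simp: in_sym_centralizer fun_eq_iff)
  have "inv_into UNIV g (r w) = r (inv_into UNIV g w)" if "r \<in> R" for r w
    by (metis \<open>bij g\<close> bij_inv_eq_iff c that)
  then show ?thesis
    using \<open>bij g\<close> by (auto simp: in_sym_centralizer bij_imp_bij_inv fun_eq_iff)
qed

lemma group_sym_centralizer: "group (sym_centralizer R)"
proof (rule groupI)
  fix g assume "g \<in> carrier (sym_centralizer R)"
  then show "\<exists>h\<in>carrier (sym_centralizer R). h \<otimes>\<^bsub>sym_centralizer R\<^esub> g = \<one>\<^bsub>sym_centralizer R\<^esub>"
    using sym_centralizer_inv_closed
    by (intro bexI[of _ "inv_into UNIV g"]) (auto simp: in_sym_centralizer bij_is_inj)
qed (auto simp: in_sym_centralizer bij_comp fun_eq_iff)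

lemma sym_centralizer_inv:
  assumes "g \<in> carrier (sym_centralizer R)"
  shows "inv\<^bsub>sym_centralizer R\<^esub> g = inv_into UNIV g"
proof -
  interpret group "sym_centralizer R" by (rule group_sym_centralizer)
  show ?thesis
    using assms sym_centralizer_inv_closed[OF assms]
    by (intro inv_equality) (auto simp: in_sym_centralizer bij_is_inj)
qed

text \<open>Inversion is pointwise continuous on permutations, although it is not defined coordinatewise: the
value of the inverse at \<open>w\<close> is \<open>v\<close> as soon as the permutation sends \<open>v\<close> to \<open>w\<close>.\<close>

lemma eventually_inv_eq:
  fixes g :: "nat \<Rightarrow> nat"
  assumes "bij g"
  shows "\<forall>\<^sub>F h in nhds g. bij h \<longrightarrow> inv_into UNIV h w = inv_into UNIV g w"
  using eventually_eq_coordinate[of "inv_into UNIV g w" g]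
proof eventually_elim
  case (elim h)
  then show ?case
    by (metis assms bij_inv_eq_iff)
qed

lemma topological_group_sym_centralizer:
  "topological_group (sym_centralizer R) (pointwise_topology (sym_centralizer R))"
proof -
  let ?G = "sym_centralizer R"
  interpret group ?G by (rule group_sym_centralizer)
  have "continuous_on (carrier ?G \<times> carrier ?G) (\<lambda>(g, h). g \<circ> h)"
  proof (rule continuous_on_coordinatewise_then_product)
    fix n
    show "continuous_on (carrier ?G \<times> carrier ?G) (\<lambda>x. (case x of (g, h) \<Rightarrow> g \<circ> h) n)"
    proof (rule continuous_on_locally_constant, clarify)
      fix g h :: "nat \<Rightarrow> nat"
      have "\<forall>\<^sub>F p in nhds g \<times>\<^sub>F nhds h. snd p n = h n \<and> fst p (h n) = g (h n)"
        using eventually_prodI[OF eventually_eq_coordinate[of "h n" g] eventually_eq_coordinate[of n h]]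
        by (auto elim: eventually_mono)
      then show "\<forall>\<^sub>F y in nhds (g, h). y \<in> carrier ?G \<times> carrier ?G \<longrightarrow>
          (case y of (g, h) \<Rightarrow> g \<circ> h) n = (g \<circ> h) n"
        unfolding nhds_prod by (auto elim!: eventually_mono)
    qed
  qed
  moreover have "continuous_on (carrier ?G) (\<lambda>g. inv\<^bsub>?G\<^esub> g)"
  proof (rule continuous_on_coordinatewise_then_product, rule continuous_on_locally_constant)
    fix n g assume g: "g \<in> carrier ?G"
    then have "\<forall>\<^sub>F h in nhds g. bij h \<longrightarrow> inv_into UNIV h n = inv_into UNIV g n"
      by (intro eventually_inv_eq) (simp add: in_sym_centralizer)
    then show "\<forall>\<^sub>F h in nhds g. h \<in> carrier ?G \<longrightarrow> (inv\<^bsub>?G\<^esub> h) n = (inv\<^bsub>?G\<^esub> g) n"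
      using g by (auto elim!: eventually_mono simp: sym_centralizer_inv in_sym_centralizer)
  qed
  ultimately show ?thesis
    by unfold_locales
      (auto simp: pointwise_topology_def in_sym_centralizer bij_comp comp_assoc
        sym_centralizer_inv_closed sym_centralizer_inv split_beta fun_eq_iff
        simp flip: subtopology_Times
        intro!: continuous_map_into_subtopology)
qed

text \<open>Injectivity and commutation are closed conditions, but surjectivity is a countable intersection of
open ones; so the centralizer is a \<open>G\<^sub>\<delta>\<close> set in the Baire space, and it is not in general closed
there.\<close>

lemma Polish_group_sym_centralizer:
  "Polish_group (sym_centralizer R) (pointwise_topology (sym_centralizer R))"
proof -
  let ?G = "sym_centralizer R"
  interpret topological_group ?G "pointwise_topology ?G"
    by (rule topological_group_sym_centralizer)
  have "(euclidean :: nat topology) = discrete_topology UNIV"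
    by (simp add: topology_eq open_discrete)
  then have cmet: "completely_metrizable_space (euclidean :: (nat \<Rightarrow> nat) topology)"
    by (simp add: completely_metrizable_space_product_topology
        completely_metrizable_space_discrete_topology flip: euclidean_product_topology)
  then have met: "metrizable_space (euclidean :: (nat \<Rightarrow> nat) topology)"
    by (rule completely_metrizable_imp_metrizable_space)
  have co: "closed {g::nat \<Rightarrow> nat. P (g i) (g j)}" for P i j
  proof -
    have "continuous_on UNIV (\<lambda>g::nat \<Rightarrow> nat. P (g i) (g j))"
    proof (rule continuous_on_locally_constant)
      fix g :: "nat \<Rightarrow> nat"
      show "\<forall>\<^sub>F h in nhds g. h \<in> UNIV \<longrightarrow> P (h i) (h j) = P (g i) (g j)"
        using eventually_eq_coordinate[of i g] eventually_eq_coordinate[of j g]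
        by eventually_elim simp
    qed
    then have "closed ((\<lambda>g::nat \<Rightarrow> nat. P (g i) (g j)) -` {True})"
      by (intro closed_vimage) (auto simp: closed_def open_discrete)
    then show ?thesis by (simp add: vimage_def)
  qed
  have surj_iff: "surj g \<longleftrightarrow> (\<forall>n. \<exists>i. g i = n)" for g :: "nat \<Rightarrow> nat"
    by (metis surj_def)
  have "carrier ?G = (\<Inter>i j. {g. g i = g j \<longrightarrow> i = j}) \<inter> (\<Inter>r\<in>R. \<Inter>i. {g. g (r i) = r (g i)})
          \<inter> (\<Inter>n. \<Union>i. {g. g i = n})"
    using surj_iff by (auto simp: in_sym_centralizer bij_def inj_def fun_eq_iff)
  moreover have "gdelta_in euclidean (\<Inter>i j. {g::nat \<Rightarrow> nat. g i = g j \<longrightarrow> i = j})"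
    by (intro closed_imp_gdelta_in met, unfold closed_closedin[symmetric])
      (intro closed_INT ballI co[of "\<lambda>a b. a = b \<longrightarrow> i = j" i j for i j])
  moreover have "gdelta_in euclidean (\<Inter>r\<in>R. \<Inter>i. {g. g (r i) = r (g i)})"
    by (intro closed_imp_gdelta_in met, unfold closed_closedin[symmetric])
      (intro closed_INT ballI co[of "\<lambda>a b. a = r b" "r i" i for r i])
  moreover have "gdelta_in euclidean (\<Inter>n. \<Union>i. {g::nat \<Rightarrow> nat. g i = n})"
  proof -
    have "open {g::nat \<Rightarrow> nat. g i = n}" for i n
      using co[of "\<lambda>a b. a \<noteq> n" i i] by (simp add: closed_def Collect_neg_eq)
    then show ?thesis
      by (intro gdelta_in_Inter) (auto intro!: open_imp_gdelta_in open_UN)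
  qed
  ultimately have "gdelta_in euclidean (carrier ?G)"
    by (simp add: gdelta_in_Int)
  then have "completely_metrizable_space (pointwise_topology ?G)"
    unfolding pointwise_topology_def
    by (intro completely_metrizable_space_gdelta_in cmet)
  moreover have "separable_space (pointwise_topology ?G)"
    unfolding pointwise_topology_def
    by (intro second_countable_imp_separable_space second_countable_subtopology
        second_countable_euclidean)
  ultimately show ?thesis by unfold_locales
qed

section \<open>A wreath product times the integers\<close>

text \<open>The countable group \<open>F\<close> is given by self-maps of a type, with composition as multiplication, so
that it comes with its action on the space \<open>X\<close>.\<close>

locale countable_transformation_group =
  fixes F :: "('x \<Rightarrow> 'x) set"
  assumes countable_F: "countable F"
    and id_mem [simp]: "id \<in> F"
    and comp_mem [simp]: "\<And>f h. f \<in> F \<Longrightarrow> h \<in> F \<Longrightarrow> f \<circ> h \<in> F"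
    and inverse_mem: "\<And>f. f \<in> F \<Longrightarrow> \<exists>h\<in>F. h \<circ> f = id \<and> f \<circ> h = id"
begin

text \<open>The points \<open>Inl y\<close> form the line, and the points \<open>Inr (n, h)\<close> with fixed \<open>n\<close> form a regular orbit
of \<open>F\<close>. The set is countably infinite because of the line, so it can be identified with the natural
numbers.\<close>

definition points :: "(int + nat \<times> ('x \<Rightarrow> 'x)) set" where
  "points = UNIV <+> (UNIV \<times> F)"

definition line_pt :: "int \<Rightarrow> nat" where
  "line_pt y = to_nat_on points (Inl y)"

definition orbit_pt :: "nat \<Rightarrow> ('x \<Rightarrow> 'x) \<Rightarrow> nat" where
  "orbit_pt n h = to_nat_on points (Inr (n, h))"

lemma bij_betw_points: "bij_betw (to_nat_on points) points UNIV"
proof (rule to_nat_on_infinite)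
  show "countable points"
    using countable_F by (simp add: points_def)
  show "infinite points"
    using infinite_UNIV_int by (auto simp: points_def finite_Plus_iff)
qed

lemma decode_pt [simp]:
  "inv_into points (to_nat_on points) (line_pt y) = Inl y"
  "h \<in> F \<Longrightarrow> inv_into points (to_nat_on points) (orbit_pt n h) = Inr (n, h)"
proof -
  have "Inl y \<in> points" and "h \<in> F \<Longrightarrow> Inr (n, h) \<in> points"
    by (auto simp: points_def)
  then show "inv_into points (to_nat_on points) (line_pt y) = Inl y"
    and "h \<in> F \<Longrightarrow> inv_into points (to_nat_on points) (orbit_pt n h) = Inr (n, h)"
    by (simp_all add: line_pt_def orbit_pt_def bij_betw_inv_into_left[OF bij_betw_points])
qed

lemma pt_eq_iff [simp]:
  "line_pt y = line_pt y' \<longleftrightarrow> y = y'"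
  "h \<in> F \<Longrightarrow> line_pt y \<noteq> orbit_pt n h"
  "h \<in> F \<Longrightarrow> orbit_pt n h \<noteq> line_pt y"
  "h \<in> F \<Longrightarrow> h' \<in> F \<Longrightarrow> orbit_pt n h = orbit_pt n' h' \<longleftrightarrow> n = n' \<and> h = h'"
  by (metis decode_pt sum.inject sum.distinct Pair_inject)+

lemma pt_cases [case_names line orbit]:
  obtains y where "w = line_pt y" | n h where "h \<in> F" "w = orbit_pt n h"
proof -
  have "w \<in> to_nat_on points ` points"
    using bij_betw_points by (simp add: bij_betw_def)
  then show ?thesis
    using that by (auto simp: points_def line_pt_def orbit_pt_def)
qed

text \<open>The element \<open>(z, c, \<sigma>)\<close> of \<open>\<int> \<times> (F wr Sym(\<nat>))\<close> as a permutation. It multiplies by \<open>c n\<close> on the right,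
since it has to commute with the left multiplications.\<close>

definition wreath_elt :: "int \<Rightarrow> (nat \<Rightarrow> 'x \<Rightarrow> 'x) \<Rightarrow> (nat \<Rightarrow> nat) \<Rightarrow> nat \<Rightarrow> nat" where
  "wreath_elt z c \<sigma> w = (case inv_into points (to_nat_on points) w of
      Inl y \<Rightarrow> line_pt (y + z)
    | Inr (n, h) \<Rightarrow> orbit_pt (\<sigma> n) (h \<circ> c n))"

definition left_mult :: "('x \<Rightarrow> 'x) \<Rightarrow> nat \<Rightarrow> nat" where
  "left_mult r w = (case inv_into points (to_nat_on points) w of
      Inl y \<Rightarrow> line_pt y
    | Inr (n, h) \<Rightarrow> orbit_pt n (r \<circ> h))"

lemma wreath_elt_pt [simp]:
  "wreath_elt z c \<sigma> (line_pt y) = line_pt (y + z)"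
  "h \<in> F \<Longrightarrow> wreath_elt z c \<sigma> (orbit_pt n h) = orbit_pt (\<sigma> n) (h \<circ> c n)"
  by (simp_all add: wreath_elt_def)

lemma left_mult_pt [simp]:
  "left_mult r (line_pt y) = line_pt y"
  "h \<in> F \<Longrightarrow> left_mult r (orbit_pt n h) = orbit_pt n (r \<circ> h)"
  by (simp_all add: left_mult_def)

definition G :: "(nat \<Rightarrow> nat) monoid" where
  "G = sym_centralizer (insert (wreath_elt 1 (\<lambda>_. id) id) (left_mult ` F))"

definition wreath_data :: "(nat \<Rightarrow> 'x \<Rightarrow> 'x) \<Rightarrow> (nat \<Rightarrow> nat) \<Rightarrow> bool" where
  "wreath_data c \<sigma> \<longleftrightarrow> (\<forall>n. c n \<in> F) \<and> bij \<sigma>"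

lemma wreath_dataD [simp]: "wreath_data c \<sigma> \<Longrightarrow> c n \<in> F"
  by (simp add: wreath_data_def)

lemma fun_eq_on_pts:
  assumes "\<And>y. f (line_pt y) = g (line_pt y)" "\<And>n h. h \<in> F \<Longrightarrow> f (orbit_pt n h) = g (orbit_pt n h)"
  shows "f = g"
proof
  fix w show "f w = g w"
    by (cases w rule: pt_cases) (use assms in auto)
qed

lemma wreath_elt_comp:
  assumes "wreath_data c \<sigma>" "wreath_data c' \<sigma>'"
  shows "wreath_elt z c \<sigma> \<circ> wreath_elt z' c' \<sigma>' = wreath_elt (z + z') (\<lambda>n. c' n \<circ> c (\<sigma>' n)) (\<sigma> \<circ> \<sigma>')"
  using assms by (intro fun_eq_on_pts) (simp_all add: comp_assoc algebra_simps)

lemma right_cancel: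
  assumes "f \<circ> c = h \<circ> c" "c \<in> F"
  shows "f = h"
  using inverse_mem[OF \<open>c \<in> F\<close>] assms(1) by (metis comp_assoc comp_id)

lemma bij_wreath_elt:
  assumes "wreath_data c \<sigma>"
  shows "bij (wreath_elt z c \<sigma>)"
proof (rule bijI)
  have \<sigma>: "bij \<sigma>"
    using assms by (simp add: wreath_data_def)
  show "inj (wreath_elt z c \<sigma>)"
  proof (rule injI)
    fix v w assume *: "wreath_elt z c \<sigma> v = wreath_elt z c \<sigma> w"
    show "v = w"
      by (cases v rule: pt_cases; cases w rule: pt_cases)
        (use * assms \<sigma> in \<open>auto simp: bij_is_inj inj_eq dest: right_cancel\<close>)
  qed
  have "\<exists>v. wreath_elt z c \<sigma> v = w" for w
  proof (cases w rule: pt_cases)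
    case (line y)
    then have "wreath_elt z c \<sigma> (line_pt (y - z)) = w"
      by simp
    then show ?thesis ..
  next
    case (orbit n h)
    obtain m where m: "n = \<sigma> m"
      using \<sigma> by (meson bij_pointE)
    obtain k where k: "k \<in> F" "k \<circ> c m = id"
      using inverse_mem[of "c m"] assms by auto
    have "wreath_elt z c \<sigma> (orbit_pt m (h \<circ> k)) = w"
      using orbit k m by (simp add: comp_assoc)
    then show ?thesis ..
  qed
  then show "surj (wreath_elt z c \<sigma>)"
    by (metis surj_def)
qed

lemma wreath_elt_in_carrier:
  assumes "wreath_data c \<sigma>"
  shows "wreath_elt z c \<sigma> \<in> carrier G"
proof -
  have "wreath_elt z c \<sigma> \<circ> wreath_elt 1 (\<lambda>_. id) id = wreath_elt 1 (\<lambda>_. id) id \<circ> wreath_elt z c \<sigma>"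
    using assms by (intro fun_eq_on_pts) (simp_all add: add_ac)
  moreover have "wreath_elt z c \<sigma> \<circ> left_mult r = left_mult r \<circ> wreath_elt z c \<sigma>" if "r \<in> F" for r
    using assms that by (intro fun_eq_on_pts) (simp_all add: comp_assoc)
  ultimately show ?thesis
    using assms by (simp add: G_def in_sym_centralizer bij_wreath_elt)
qed

text \<open>Every element of the centralizer comes from the wreath product. The shift moves exactly the points
of the line, so a permutation that commutes with it preserves the line and acts there as a
translation. On the regular orbits the image of the points \<open>(n, id)\<close> determines everything.\<close>

lemma in_carrier_cases:
  assumes "g \<in> carrier G"
  obtains z c \<sigma> where "wreath_data c \<sigma>" "g = wreath_elt z c \<sigma>"
proof -
  let ?t = "wreath_elt 1 (\<lambda>_. id) id"
  have "bij g" and t: "\<And>w. g (?t w) = ?t (g w)"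
    and r: "\<And>r w. r \<in> F \<Longrightarrow> g (left_mult r w) = left_mult r (g w)"
    using assms by (auto simp: G_def in_sym_centralizer fun_eq_iff)
  have t_fixed: "?t w = w \<longleftrightarrow> (\<forall>y. w \<noteq> line_pt y)" for w
    by (cases w rule: pt_cases) auto
  have t_fixed_iff: "?t (g w) = g w \<longleftrightarrow> ?t w = w" for w
    using t[of w] \<open>bij g\<close> by (metis bij_is_inj inj_eq)
  obtain z where z: "g (line_pt 0) = line_pt z"
    using t_fixed_iff[of "line_pt 0"] by (auto simp only: t_fixed)
  have step: "g (line_pt (y + 1)) = line_pt (y + 1 + z) \<longleftrightarrow> g (line_pt y) = line_pt (y + z)" for y
  proof -
    have "g (line_pt (y + 1)) = ?t (g (line_pt y))"
      using t[of "line_pt y"] by simp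
    moreover have "line_pt (y + 1 + z) = ?t (line_pt (y + z))"
      by (simp add: add_ac)
    moreover have "inj ?t"
      using bij_wreath_elt[of "\<lambda>_. id" id 1] by (simp add: wreath_data_def bij_is_inj)
    ultimately show ?thesis
      by (metis inj_eq)
  qed
  have line: "g (line_pt y) = line_pt (y + z)" for y
  proof (induction y rule: int_induct[where k = 0])
    case (step2 i)
    then show ?case
      using step[of "i - 1"] by simp
  qed (use z step in auto)
  have "\<exists>m k. k \<in> F \<and> g (orbit_pt n id) = orbit_pt m k" for n
    using t_fixed_iff[of "orbit_pt n id"]
    by (cases "g (orbit_pt n id)" rule: pt_cases) (auto simp only: t_fixed pt_eq_iff id_mem)
  then obtain \<sigma> c where c: "\<And>n. c n \<in> F" and "\<And>n. g (orbit_pt n id) = orbit_pt (\<sigma> n) (c n)"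
    by metis
  then have orbit: "g (orbit_pt n h) = orbit_pt (\<sigma> n) (h \<circ> c n)" if "h \<in> F" for n h
    using r[OF that, of "orbit_pt n id"] that by simp
  have g: "g = wreath_elt z c \<sigma>"
    by (intro fun_eq_on_pts) (simp_all add: line orbit)
  have "bij \<sigma>"
  proof (rule bijI)
    show "inj \<sigma>"
    proof (rule injI)
      fix n m assume nm: "\<sigma> n = \<sigma> m"
      obtain h k where "h \<in> F" "h \<circ> c n = id" "k \<in> F" "k \<circ> c m = id"
        using inverse_mem[OF c] by metis
      then have "g (orbit_pt n h) = g (orbit_pt m k)"
        by (simp add: orbit nm)
      then show "n = m"
        using \<open>bij g\<close> \<open>h \<in> F\<close> \<open>k \<in> F\<close> by (auto simp: bij_is_inj inj_eq)
    qed
    have "\<exists>n. \<sigma> n = m" for m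
    proof -
      obtain w where w: "g w = orbit_pt m id"
        using \<open>bij g\<close> by (metis bij_pointE)
      show ?thesis
        by (cases w rule: pt_cases) (use w c in \<open>auto simp: line orbit\<close>)
    qed
    then show "surj \<sigma>"
      by (metis surj_def)
  qed
  then show ?thesis
    using that[of c \<sigma> z] c g by (simp add: wreath_data_def)
qed

end

section \<open>The wreath product is coarsely bounded\<close>

text \<open>The involution that exchanges \<open>u i\<close> and \<open>M + i\<close> for all \<open>i < n\<close>, provided that the values \<open>u i\<close> are
distinct and below \<open>M\<close>.\<close>

definition swap_blocks :: "nat \<Rightarrow> (nat \<Rightarrow> nat) \<Rightarrow> nat \<Rightarrow> nat \<Rightarrow> nat" where
  "swap_blocks n u M x =
     (if x \<in> u ` {..<n} then M + inv_into {..<n} u x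
      else if x \<in> {M..<M + n} then u (x - M) else x)"

lemma swap_blocks_simps:
  assumes "inj_on u {..<n}" "\<And>i. i < n \<Longrightarrow> u i < M"
  shows "i < n \<Longrightarrow> swap_blocks n u M (u i) = M + i"
    and "i < n \<Longrightarrow> swap_blocks n u M (M + i) = u i"
    and "x \<notin> u ` {..<n} \<Longrightarrow> x \<notin> {M..<M + n} \<Longrightarrow> swap_blocks n u M x = x"
  using assms by (force simp: swap_blocks_def)+

lemma swap_blocks_involution:
  assumes "inj_on u {..<n}" "\<And>i. i < n \<Longrightarrow> u i < M"
  shows "swap_blocks n u M \<circ> swap_blocks n u M = id"
proof
  fix x
  note s = swap_blocks_simps[OF assms]
  consider i where "i < n" "x = u i" | i where "i < n" "x = M + i" | "x \<notin> u ` {..<n}" "x \<notin> {M..<M + n}"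
    by (metis add_diff_inverse_nat atLeastLessThan_iff imageE lessThan_iff nat_add_left_cancel_less not_le)
  then show "(swap_blocks n u M \<circ> swap_blocks n u M) x = id x"
    by cases (simp_all add: s)
qed

context countable_transformation_group
begin

text \<open>Call an element small if it is trivial on the first \<open>n\<close> coordinates; \<open>\<tau> M\<close> exchanges the block
\<open>{..<n}\<close> with the block of length \<open>n\<close> that starts at \<open>M\<close>. All \<open>\<tau> M\<close> are conjugate to \<open>\<tau> n\<close> by small
permutations, so their lengths are bounded together. For an arbitrary permutation \<open>\<sigma>\<close>, some
\<open>\<tau> M\<close> moves the image of the block out of the block, a small permutation carries it to the block at
some \<open>M'\<close>, and \<open>\<tau> M'\<close> brings it back; the resulting product is small. An element of the base group
is the product of a small one and of one supported on the first \<open>n\<close> coordinates, and the latter is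
conjugate to a small one by \<open>\<tau> n\<close>.\<close>

lemma wreath_product_bounded:
  fixes len :: "(nat \<Rightarrow> nat) \<Rightarrow> real"
  assumes sub: "\<And>g h. g \<in> carrier G \<Longrightarrow> h \<in> carrier G \<Longrightarrow> len (g \<circ> h) \<le> len g + len h"
    and small: "\<And>c \<sigma>. wreath_data c \<sigma> \<Longrightarrow> (\<And>i. i < n \<Longrightarrow> c i = id \<and> \<sigma> i = i) \<Longrightarrow> len (wreath_elt 0 c \<sigma>) \<le> 1"
  shows "\<exists>C. \<forall>c \<sigma>. wreath_data c \<sigma> \<longrightarrow> len (wreath_elt 0 c \<sigma>) \<le> C"
proof -
  define P where "P = wreath_elt 0 (\<lambda>_. id)"
  define \<tau> where "\<tau> = swap_blocks n (\<lambda>i. i)"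
  define K where "K = len (P (\<tau> n))"
  have data_perm [simp]: "wreath_data (\<lambda>_. id) \<sigma> \<longleftrightarrow> bij \<sigma>" for \<sigma>
    by (simp add: wreath_data_def)
  have P_in: "P \<sigma> \<in> carrier G" if "bij \<sigma>" for \<sigma>
    using that by (simp add: P_def wreath_elt_in_carrier)
  have P_comp: "P (\<sigma> \<circ> \<sigma>') = P \<sigma> \<circ> P \<sigma>'" if "bij \<sigma>" "bij \<sigma>'" for \<sigma> \<sigma>'
    using that by (simp add: P_def wreath_elt_comp)
  have P_sub: "len (P (\<sigma> \<circ> \<sigma>')) \<le> len (P \<sigma>) + len (P \<sigma>')" if "bij \<sigma>" "bij \<sigma>'" for \<sigma> \<sigma>'
    using that by (simp add: P_comp sub P_in)
  have P_small: "len (P \<sigma>) \<le> 1" if "bij \<sigma>" "\<And>i. i < n \<Longrightarrow> \<sigma> i = i" for \<sigma>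
    using that by (simp add: P_def small)
  have bij_swap: "bij (swap_blocks n u M)" if "inj_on u {..<n}" "\<And>i. i < n \<Longrightarrow> u i < M" for u M
    using swap_blocks_involution[OF that] by (metis o_bij)
  have \<tau>_simps: "i < n \<Longrightarrow> \<tau> M i = M + i" "i < n \<Longrightarrow> \<tau> M (M + i) = i"
    "n \<le> x \<Longrightarrow> x \<notin> {M..<M + n} \<Longrightarrow> \<tau> M x = x" if "n \<le> M" for i x M
    using swap_blocks_simps[of "\<lambda>i. i" n M] that by (auto simp: \<tau>_def)
  have \<tau>\<tau>: "\<tau> M \<circ> \<tau> M = id" and bij_\<tau>: "bij (\<tau> M)" if "n \<le> M" for M
    unfolding \<tau>_def using that by (intro swap_blocks_involution bij_swap; simp)+
  have \<tau>_bound: "len (P (\<tau> M)) \<le> K + 2" if M: "2 * n \<le> M" for M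
  proof -
    define v where "v = swap_blocks n (\<lambda>i. n + i) M"
    have u: "inj_on (\<lambda>i. n + i) {..<n}" "\<And>i. i < n \<Longrightarrow> n + i < M"
      using M by auto
    note v = swap_blocks_simps[OF u, folded v_def]
    have "bij v"
      unfolding v_def using u by (intro bij_swap) auto
    have v3: "v x = x" if "x < n \<or> (2 * n \<le> x \<and> x \<notin> {M..<M + n})" for x
      by (rule v(3)) (use that M in auto)
    \<comment> \<open>The small permutation \<open>v\<close> carries the block at \<open>n\<close> to the block at \<open>M\<close>.\<close>
    have "\<tau> M = v \<circ> \<tau> n \<circ> v"
    proof
      fix x
      consider "x < n" | i where "i < n" "x = n + i" | i where "i < n" "x = M + i"
        | "2 * n \<le> x" "x \<notin> {M..<M + n}"
        by (metis add_diff_inverse_nat atLeastLessThan_iff mult_2 nat_add_left_cancel_less not_le)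
      then show "\<tau> M x = (v \<circ> \<tau> n \<circ> v) x"
        by cases (use M in \<open>auto simp: v(1,2) v3 \<tau>_simps\<close>)
    qed
    then have "len (P (\<tau> M)) \<le> len (P v) + K + len (P v)"
      using P_sub[of "v \<circ> \<tau> n" v] P_sub[of v "\<tau> n"] \<open>bij v\<close> bij_\<tau>[of n]
      by (simp add: K_def bij_comp)
    moreover have "len (P v) \<le> 1"
      using \<open>bij v\<close> v3 by (intro P_small) auto
    ultimately show ?thesis by simp
  qed
  have above: "\<exists>M\<ge>2 * n. \<forall>i<n. u i < M" for u :: "nat \<Rightarrow> nat"
  proof -
    obtain m where "\<forall>x\<in>u ` {..<n}. x < m"
      using finite_nat_set_iff_bounded by blast
    then show ?thesis
      by (intro exI[of _ "max m (2 * n)"]) (auto simp: less_max_iff_disj)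
  qed
  have perm_bound: "len (P \<sigma>) \<le> 2 * K + 6" if \<sigma>: "bij \<sigma>" for \<sigma>
  proof -
    obtain M where M: "2 * n \<le> M" "\<And>i. i < n \<Longrightarrow> \<sigma> i < M"
      using above by blast
    define \<sigma>' where "\<sigma>' = \<tau> M \<circ> \<sigma>"
    have \<sigma>'_ge: "n \<le> \<sigma>' i" if "i < n" for i
      using M(1) M(2)[OF that] by (cases "\<sigma> i < n") (simp_all add: \<sigma>'_def \<tau>_simps)
    have "bij \<sigma>'"
      using \<sigma> M bij_\<tau>[of M] by (simp add: \<sigma>'_def bij_comp)
    then have inj: "inj_on \<sigma>' {..<n}"
      by (meson bij_is_inj inj_on_subset subset_UNIV)
    obtain M' where M': "2 * n \<le> M'" "\<And>i. i < n \<Longrightarrow> \<sigma>' i < M'"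
      using above by blast
    define v where "v = swap_blocks n \<sigma>' M'"
    note v = swap_blocks_simps[OF inj M'(2), folded v_def]
    have "bij v" and vv: "v \<circ> v = id"
      unfolding v_def using inj M' by (intro bij_swap swap_blocks_involution; simp)+
    have v_small: "len (P v) \<le> 1"
      using \<open>bij v\<close> \<sigma>'_ge M'(1) by (intro P_small v(3)) (auto simp: not_less[symmetric])
    define \<pi> where "\<pi> = \<tau> M' \<circ> v \<circ> \<sigma>'"
    have "bij \<pi>"
      using \<open>bij v\<close> \<open>bij \<sigma>'\<close> M' bij_\<tau>[of M'] by (simp add: \<pi>_def bij_comp)
    have "len (P \<pi>) \<le> 1"
      using \<open>bij \<pi>\<close> M'(1) by (intro P_small) (auto simp: \<pi>_def v \<tau>_simps)
    have "\<tau> M \<circ> v \<circ> \<tau> M' \<circ> \<pi> = \<tau> M \<circ> (v \<circ> (\<tau> M' \<circ> \<tau> M') \<circ> v) \<circ> \<tau> M \<circ> \<sigma>"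
      by (simp add: \<pi>_def \<sigma>'_def comp_assoc)
    also have "\<dots> = \<sigma>"
      using \<tau>\<tau>[of M] \<tau>\<tau>[of M'] M(1) M'(1) vv by simp
    finally have "P \<sigma> = P (\<tau> M \<circ> v \<circ> \<tau> M' \<circ> \<pi>)"
      by simp
    moreover have "bij (\<tau> M)" "bij (\<tau> M')"
      using bij_\<tau> M M' by simp_all
    ultimately have "len (P \<sigma>) \<le> len (P (\<tau> M)) + len (P v) + len (P (\<tau> M')) + len (P \<pi>)"
      using P_sub[of "\<tau> M \<circ> v \<circ> \<tau> M'" \<pi>] P_sub[of "\<tau> M \<circ> v" "\<tau> M'"] P_sub[of "\<tau> M" v]
        \<open>bij v\<close> \<open>bij \<pi>\<close> by (simp add: bij_comp)
    then show ?thesis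
      using \<tau>_bound[OF M(1)] \<tau>_bound[OF M'(1)] v_small \<open>len (P \<pi>) \<le> 1\<close> by simp
  qed
  have base_bound: "len (wreath_elt 0 c id) \<le> 2 * K + 2" if c: "\<And>i. c i \<in> F" for c
  proof -
    define c1 where "c1 i = (if i < n then id else c i)" for i
    define c2 where "c2 i = (if i < n then c i else id)" for i
    define c3 where "c3 = c2 \<circ> \<tau> n"
    have data: "wreath_data c1 id" "wreath_data c2 id" "wreath_data c3 id"
      using c by (simp_all add: wreath_data_def c1_def c2_def c3_def)
    have "c2 i \<circ> c1 i = c i" for i
      by (simp add: c1_def c2_def)
    then have "wreath_elt 0 c id = wreath_elt 0 c1 id \<circ> wreath_elt 0 c2 id"
      by (simp add: wreath_elt_comp[OF data(1,2)])
    then have "len (wreath_elt 0 c id) \<le> len (wreath_elt 0 c1 id) + len (wreath_elt 0 c2 id)"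
      using data by (simp add: sub wreath_elt_in_carrier)
    moreover have "len (wreath_elt 0 c1 id) \<le> 1"
      using data by (intro small) (auto simp: c1_def)
    moreover have "len (wreath_elt 0 c3 id) \<le> 1"
      using data by (intro small) (auto simp: c3_def c2_def \<tau>_simps)
    moreover have "len (wreath_elt 0 c2 id) \<le> K + len (wreath_elt 0 c3 id) + K"
    proof -
      have \<tau>n: "bij (\<tau> n)" "\<tau> n \<circ> \<tau> n = id"
        using bij_\<tau>[of n] \<tau>\<tau>[of n] by simp_all
      have "wreath_data c3 (\<tau> n)"
        using \<tau>n data(3) by (simp add: wreath_data_def)
      moreover have "c3 (\<tau> n i) = c2 i" for i
        using \<tau>n(2) by (simp add: c3_def fun_eq_iff)
      ultimately have "wreath_elt 0 c2 id = P (\<tau> n) \<circ> wreath_elt 0 c3 id \<circ> P (\<tau> n)"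
        using \<tau>n data by (simp add: P_def wreath_elt_comp)
      then show ?thesis
        using sub[of "P (\<tau> n) \<circ> wreath_elt 0 c3 id" "P (\<tau> n)"] sub[of "P (\<tau> n)" "wreath_elt 0 c3 id"]
          \<tau>n data P_in[of "\<tau> n"] wreath_elt_in_carrier[of c3 id 0] \<open>wreath_data c3 (\<tau> n)\<close>
          wreath_elt_in_carrier[of c3 "\<tau> n" 0]
        by (simp add: K_def P_def wreath_elt_comp)
    qed
    ultimately show ?thesis by simp
  qed
  have "len (wreath_elt 0 c \<sigma>) \<le> 4 * K + 8" if data: "wreath_data c \<sigma>" for c \<sigma>
  proof -
    have "bij \<sigma>" "wreath_data c id" "\<And>i. c i \<in> F"
      using data by (simp_all add: wreath_data_def)
    then have "wreath_elt 0 c \<sigma> = P \<sigma> \<circ> wreath_elt 0 c id"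
      by (simp add: P_def wreath_elt_comp)
    then have "len (wreath_elt 0 c \<sigma>) \<le> len (P \<sigma>) + len (wreath_elt 0 c id)"
      using \<open>bij \<sigma>\<close> \<open>wreath_data c id\<close> by (simp add: sub P_in wreath_elt_in_carrier)
    then show ?thesis
      using perm_bound[OF \<open>bij \<sigma>\<close>] base_bound[of c] \<open>\<And>i. c i \<in> F\<close> by simp
  qed
  then show ?thesis by blast
qed

end

section \<open>Metrics at bounded distance from a line\<close>

text \<open>A function \<open>d\<close> that differs by at most 1 from the pull-back of the metric of the real line. Hyperbolicity and
the classes of sequences at the upper end are read off from the line, with bounded errors.\<close>

locale quasi_line =
  fixes M :: "'a set" and d :: "'a \<Rightarrow> 'a \<Rightarrow> real" and \<rho> :: "'a \<Rightarrow> real" and e :: 'a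
  assumes approx: "\<And>x y. x \<in> M \<Longrightarrow> y \<in> M \<Longrightarrow> \<bar>d x y - \<bar>\<rho> x - \<rho> y\<bar>\<bar> \<le> 1"
    and base: "e \<in> M" "\<rho> e = 0"
begin

definition upper_end :: "(nat \<Rightarrow> 'a) set" where
  "upper_end = {x. range x \<subseteq> M \<and> filterlim (\<lambda>i. \<rho> (x i)) at_top sequentially}"

text \<open>Three distances enter the Gromov product, and the sum is halved.\<close>

lemma gromov_product_approx:
  assumes "b \<in> M" "x \<in> M" "y \<in> M"
  shows "\<bar>gromov_product d b x y -
    (\<bar>\<rho> x - \<rho> b\<bar> + \<bar>\<rho> y - \<rho> b\<bar> - \<bar>(\<rho> x - \<rho> b) - (\<rho> y - \<rho> b)\<bar>) / 2\<bar> \<le> 3 / 2"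
proof -
  have "\<bar>d b x - \<bar>\<rho> x - \<rho> b\<bar>\<bar> \<le> 1" "\<bar>d b y - \<bar>\<rho> y - \<rho> b\<bar>\<bar> \<le> 1"
    "\<bar>d x y - \<bar>\<rho> x - \<rho> y\<bar>\<bar> \<le> 1"
    using approx[of b x] approx[of b y] approx[of x y] assms
    by (simp_all add: abs_minus_commute[of "\<rho> b"])
  moreover have "\<bar>(A + B - C) - (A' + B' - C')\<bar> \<le> 3"
    if "\<bar>A - A'\<bar> \<le> 1" "\<bar>B - B'\<bar> \<le> 1" "\<bar>C - C'\<bar> \<le> 1" for A B C A' B' C' :: real
    using that unfolding abs_le_iff by linarith
  ultimately have "\<bar>(d b x + d b y - d x y) - (\<bar>\<rho> x - \<rho> b\<bar> + \<bar>\<rho> y - \<rho> b\<bar> - \<bar>\<rho> x - \<rho> y\<bar>)\<bar> \<le> 3"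
    by blast
  then show ?thesis
    by (simp add: gromov_product_def flip: diff_divide_distrib)
qed

text \<open>The Gromov product on the real line, with base point 0. It is the length of the common part of the
segments from 0, so the line is a tree.\<close>

lemma line_zero_hyperbolic:
  fixes a b c :: real
  shows "min ((\<bar>a\<bar> + \<bar>b\<bar> - \<bar>a - b\<bar>) / 2) ((\<bar>b\<bar> + \<bar>c\<bar> - \<bar>b - c\<bar>) / 2)
    \<le> (\<bar>a\<bar> + \<bar>c\<bar> - \<bar>a - c\<bar>) / 2"
  by (simp add: min_def abs_if)

lemma hyperbolic: "Gromov_hyperbolic M d"
  unfolding Gromov_hyperbolic_def
proof (intro exI[of _ 3] ballI)
  fix b x y z assume *: "b \<in> M" "x \<in> M" "y \<in> M" "z \<in> M"
  have "min a' b' - 3 \<le> c'"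
    if "min a b \<le> c" "\<bar>a' - a\<bar> \<le> 3 / 2" "\<bar>b' - b\<bar> \<le> 3 / 2" "\<bar>c' - c\<bar> \<le> 3 / 2"
    for a b c a' b' c' :: real
    using that unfolding abs_le_iff min_def by (auto split: if_splits)
  from this[OF line_zero_hyperbolic gromov_product_approx[OF *(1,2,3)]
      gromov_product_approx[OF *(1,3,4)] gromov_product_approx[OF *(1,2,4)]]
  show "min (gromov_product d b x y) (gromov_product d b y z) - 3 \<le> gromov_product d b x z" .
qed

lemma gromov_product_base:
  assumes "x \<in> M" "y \<in> M"
  shows "gromov_product d e x y \<ge> min (\<rho> x) (\<rho> y) - 3 / 2"
    and "\<rho> x \<ge> 0 \<Longrightarrow> gromov_product d e x y \<le> max 0 (\<rho> y) + 3 / 2"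
  using gromov_product_approx[OF base(1) assms] base(2)
  by (simp_all add: min_def max_def abs_if split: if_splits)

lemma gromov_product_upper_end:
  assumes "x \<in> upper_end" "y \<in> upper_end"
  shows "filterlim (\<lambda>(i, j). gromov_product d e (x i) (y j)) at_top (sequentially \<times>\<^sub>F sequentially)"
  unfolding filterlim_at_top
proof
  fix Z :: real
  have "\<forall>\<^sub>F i in sequentially. Z + 2 \<le> \<rho> (x i)" "\<forall>\<^sub>F i in sequentially. Z + 2 \<le> \<rho> (y i)"
    using assms by (simp_all add: upper_end_def filterlim_at_top)
  then have "\<forall>\<^sub>F (i, j) in sequentially \<times>\<^sub>F sequentially. Z + 2 \<le> \<rho> (x i) \<and> Z + 2 \<le> \<rho> (y j)"
    by (rule eventually_prodI[THEN eventually_mono]) auto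
  then show "\<forall>\<^sub>F p in sequentially \<times>\<^sub>F sequentially. Z \<le> (case p of (i, j) \<Rightarrow> gromov_product d e (x i) (y j))"
  proof eventually_elim
    case (elim p)
    have "x i \<in> M" "y i \<in> M" for i
      using assms by (auto simp: upper_end_def)
    then show ?case
      using elim gromov_product_base(1)[of "x (fst p)" "y (snd p)"] by (auto simp: split_beta)
  qed
qed

text \<open>If \<open>a \<ge> 0\<close>, the Gromov product of \<open>a\<close> and \<open>b\<close> on the line is \<open>min a (max 0 b)\<close>. Therefore a sequence
that is equivalent to one tending to \<open>\<infinity>\<close> tends to \<open>\<infinity>\<close> itself.\<close>

lemma upper_end_eq_class:
  assumes x: "x \<in> upper_end"
  shows "gromov_rel M d e `` {x} = upper_end"
proof
  have "upper_end \<subseteq> gromov_sequences M d e"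
    using gromov_product_upper_end by (auto simp: gromov_sequences_def upper_end_def)
  then show "upper_end \<subseteq> gromov_rel M d e `` {x}"
    using x gromov_product_upper_end by (auto simp: gromov_rel_def)
next
  show "gromov_rel M d e `` {x} \<subseteq> upper_end"
  proof
    fix y assume "y \<in> gromov_rel M d e `` {x}"
    then have y: "range y \<subseteq> M"
      and lim: "filterlim (\<lambda>(i, j). gromov_product d e (x i) (y j)) at_top (sequentially \<times>\<^sub>F sequentially)"
      by (auto simp: gromov_rel_def gromov_sequences_def)
    have "\<forall>\<^sub>F j in sequentially. Z \<le> \<rho> (y j)" for Z
    proof -
      have "\<forall>\<^sub>F p in sequentially \<times>\<^sub>F sequentially.
          max 0 Z + 2 \<le> (case p of (i, j) \<Rightarrow> gromov_product d e (x i) (y j))"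
        using lim unfolding filterlim_at_top by blast
      then obtain N where N: "\<And>i j. N \<le> i \<Longrightarrow> N \<le> j \<Longrightarrow> max 0 Z + 2 \<le> gromov_product d e (x j) (y i)"
        by (auto simp: eventually_prod_sequentially)
      have "\<forall>\<^sub>F i in sequentially. 0 \<le> \<rho> (x i)"
        using x by (auto simp: upper_end_def filterlim_at_top)
      then obtain i where i: "N \<le> i" "0 \<le> \<rho> (x i)"
        using eventually_ge_at_top[of N] by (metis (mono_tags, lifting) eventually_conj eventually_happens' sequentially_bot)
      have "Z \<le> \<rho> (y j)" if "N \<le> j" for j
      proof -
        have "x i \<in> M" "y j \<in> M"
          using x y by (auto simp: upper_end_def)
        then show ?thesis
          using N[OF that i(1)] gromov_product_base(2)[of "x i" "y j"] i(2) by linarith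
      qed
      then show ?thesis
        by (auto simp: eventually_sequentially)
    qed
    then show "y \<in> upper_end"
      using y by (simp add: upper_end_def filterlim_at_top)
  qed
qed

lemma upper_end_in_boundary:
  assumes "upper_end \<noteq> {}"
  shows "upper_end \<in> gromov_boundary M d e"
proof -
  obtain x where x: "x \<in> upper_end"
    using assms by blast
  then have "x \<in> gromov_sequences M d e"
    using gromov_product_upper_end by (auto simp: gromov_sequences_def upper_end_def)
  then show ?thesis
    using upper_end_eq_class[OF x] unfolding gromov_boundary_def by (metis quotientI)
qed

end


section \<open>The word metric and its upper end\<close>

context countable_transformation_group
begin

interpretation G: topological_group G "pointwise_topology G"
  unfolding G_def by (rule topological_group_sym_centralizer)

lemma G_simps [simp]: "g \<otimes>\<^bsub>G\<^esub> h = g \<circ> h" "\<one>\<^bsub>G\<^esub> = id"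
  by (simp_all add: G_def)

lemma data_id [simp]: "wreath_data (\<lambda>_. id) id"
  by (simp add: wreath_data_def)

text \<open>Projection to the factor \<open>\<int>\<close>, read off from the image of a single point of the line.\<close>

definition translation :: "(nat \<Rightarrow> nat) \<Rightarrow> int" where
  "translation g = (THE z. g (line_pt 0) = line_pt z)"

lemma translation_wreath_elt [simp]: "translation (wreath_elt z c \<sigma>) = z"
  by (simp add: translation_def)

lemma translation_comp:
  assumes "g \<in> carrier G" "h \<in> carrier G"
  shows "translation (g \<circ> h) = translation g + translation h"
  using assms by (elim in_carrier_cases) (simp add: wreath_elt_comp)

lemma translation_one: "translation \<one>\<^bsub>G\<^esub> = 0"
  by (simp add: translation_def)

lemma translation_inv:
  assumes "g \<in> carrier G"
  shows "translation (inv\<^bsub>G\<^esub> g) = - translation g"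
  using translation_comp[OF assms G.inv_closed[OF assms]] G.r_inv[OF assms] translation_one by simp

definition gens :: "(nat \<Rightarrow> nat) set" where
  "gens = {g \<in> carrier G. \<bar>translation g\<bar> \<le> 1}"

lemma closedin_gens: "closedin (pointwise_topology G) gens"
proof -
  have *: "\<bar>translation g\<bar> \<le> 1 \<longleftrightarrow> g (line_pt 0) \<in> line_pt ` {-1..1}" if "g \<in> carrier G" for g
    using that by (elim in_carrier_cases) (auto simp: image_iff)
  have "gens = carrier G \<inter> (\<lambda>g. g (line_pt 0)) -` (line_pt ` {-1..1})"
    using * by (auto simp: gens_def)
  moreover have "closed ((\<lambda>g::nat \<Rightarrow> nat. g (line_pt 0)) -` (line_pt ` {-1..1}))"
    by (intro closed_vimage) (auto simp: closed_def open_discrete)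
  ultimately show ?thesis
    by (simp add: pointwise_topology_def closedin_closed_Int)
qed

text \<open>A neighbourhood of the identity constrains finitely many points, and these lie on the line and on
finitely many orbits.\<close>

lemma neighbourhood_contains_stabilizer:
  assumes "open U" "id \<in> U"
  shows "\<exists>n. \<forall>c \<sigma>. wreath_data c \<sigma> \<longrightarrow> (\<forall>i<n. c i = id \<and> \<sigma> i = i) \<longrightarrow> wreath_elt 0 c \<sigma> \<in> U"
proof -
  obtain N where N: "\<And>y. (\<And>i. i < N \<Longrightarrow> y i = i) \<Longrightarrow> y \<in> U"
    using open_contains_agreeing_below[OF assms] by auto
  have "finite {i. \<exists>h\<in>F. orbit_pt i h < N}"
  proof (rule finite_surj)
    show "{i. \<exists>h\<in>F. orbit_pt i h < N} \<subseteq> (\<lambda>w. THE i. \<exists>h\<in>F. w = orbit_pt i h) ` {..<N}"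
    proof clarify
      fix i h assume "h \<in> F" "orbit_pt i h < N"
      moreover from this have "(THE j. \<exists>k\<in>F. orbit_pt i h = orbit_pt j k) = i"
        by (intro the_equality) auto
      ultimately show "i \<in> (\<lambda>w. THE i. \<exists>h\<in>F. w = orbit_pt i h) ` {..<N}"
        by (intro image_eqI[of _ _ "orbit_pt i h"]) auto
    qed
  qed simp
  then obtain n where n: "\<And>i h. h \<in> F \<Longrightarrow> orbit_pt i h < N \<Longrightarrow> i < n"
    unfolding finite_nat_set_iff_bounded by blast
  have "wreath_elt 0 c \<sigma> \<in> U" if "wreath_data c \<sigma>" "\<forall>i<n. c i = id \<and> \<sigma> i = i" for c \<sigma>
  proof (rule N)
    fix w assume "w < N"
    then show "wreath_elt 0 c \<sigma> w = w"
      by (cases w rule: pt_cases) (use n that in auto)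
  qed
  then show ?thesis by blast
qed

text \<open>The length \<open>d id\<close> is subadditive, and by continuity it is at most 1 on the elements that are trivial
on the first \<open>n\<close> coordinates for some \<open>n\<close>; so it is bounded on the wreath product, and the
generators differ from it by the three translations \<open>-1\<close>, \<open>0\<close>, \<open>1\<close>.\<close>

lemma coarsely_bounded_gens: "coarsely_bounded G (pointwise_topology G) gens"
  unfolding coarsely_bounded_def
proof (intro conjI allI impI)
  show "gens \<subseteq> carrier G"
    by (auto simp: gens_def)
  fix d assume d: "continuous_left_invariant_pseudometric G (pointwise_topology G) d"
  define len where "len = d id"
  have id_G: "id \<in> carrier G"
    using G.one_closed by simp
  have sym: "d x y = d y x" and tri: "d x z \<le> d x y + d y z"
    and inv: "d (x \<circ> y) (x \<circ> z) = d y z" and refl: "d x x = 0"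
    if "x \<in> carrier G" "y \<in> carrier G" "z \<in> carrier G" for x y z
    using d that by (auto simp: continuous_left_invariant_pseudometric_def)
  have cont: "continuous_map (prod_topology (pointwise_topology G) (pointwise_topology G))
      euclideanreal (\<lambda>(x, y). d x y)"
    using d by (simp add: continuous_left_invariant_pseudometric_def)
  have sub: "len (g \<circ> h) \<le> len g + len h" if "g \<in> carrier G" "h \<in> carrier G" for g h
    using tri[of id g "g \<circ> h"] inv[of g id h] that id_G G.m_closed[of g h] by (simp add: len_def)
  have "continuous_map (pointwise_topology G) (prod_topology (pointwise_topology G) (pointwise_topology G)) (\<lambda>g. (id, g))"
    using id_G by (simp add: continuous_map_pairwise o_def G.topspace_eq)
  then have "continuous_map (pointwise_topology G) euclideanreal len"
    using continuous_map_compose[OF _ cont, of "pointwise_topology G" "\<lambda>g. (id, g)"]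
    by (simp add: o_def len_def)
  then have "openin (pointwise_topology G) {g \<in> carrier G. len g \<in> {..<1}}"
    using openin_continuous_map_preimage[of "pointwise_topology G" euclideanreal len "{..<1}"]
    by (simp add: G.topspace_eq)
  then obtain U where U: "open U" "{g \<in> carrier G. len g < 1} = carrier G \<inter> U"
    by (auto simp: pointwise_topology_def openin_open)
  moreover have "len id < 1"
    using refl[OF id_G id_G id_G] by (simp add: len_def)
  ultimately have "id \<in> U"
    using id_G by blast
  obtain n where n: "\<And>c \<sigma>. wreath_data c \<sigma> \<Longrightarrow> (\<And>i. i < n \<Longrightarrow> c i = id \<and> \<sigma> i = i) \<Longrightarrow> wreath_elt 0 c \<sigma> \<in> U"
    using neighbourhood_contains_stabilizer[OF U(1) \<open>id \<in> U\<close>] by metis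
  have "len (wreath_elt 0 c \<sigma>) \<le> 1" if "wreath_data c \<sigma>" "\<And>i. i < n \<Longrightarrow> c i = id \<and> \<sigma> i = i" for c \<sigma>
  proof -
    have "wreath_elt 0 c \<sigma> \<in> {g \<in> carrier G. len g < 1}"
      unfolding U(2) using n[OF that] wreath_elt_in_carrier[OF that(1), of 0] by blast
    then show ?thesis by simp
  qed
  then obtain C where C: "\<And>c \<sigma>. wreath_data c \<sigma> \<Longrightarrow> len (wreath_elt 0 c \<sigma>) \<le> C"
    using wreath_product_bounded[of len n] sub by metis
  define B where "B = Max ((\<lambda>z. len (wreath_elt z (\<lambda>_. id) id)) ` {-1..1})"
  have bound: "len g \<le> B + C" if g_gens: "g \<in> gens" for g
  proof -
    obtain z c \<sigma> where g: "wreath_data c \<sigma>" "g = wreath_elt z c \<sigma>"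
      using g_gens in_carrier_cases[of g] unfolding gens_def by blast
    with g_gens have "z \<in> {-1..1}"
      by (auto simp: gens_def)
    then have "len (wreath_elt z (\<lambda>_. id) id) \<le> B"
      unfolding B_def by (intro Max_ge) auto
    moreover have "g = wreath_elt z (\<lambda>_. id) id \<circ> wreath_elt 0 c \<sigma>"
      using g by (simp add: wreath_elt_comp)
    ultimately show ?thesis
      using sub[of "wreath_elt z (\<lambda>_. id) id" "wreath_elt 0 c \<sigma>"] C[OF g(1)] g(1) by (simp add: wreath_elt_in_carrier)
  qed
  show "\<exists>C. \<forall>x\<in>gens. \<forall>y\<in>gens. d x y \<le> C"
  proof (intro exI[of _ "2 * (B + C)"] ballI)
    fix x y assume "x \<in> gens" "y \<in> gens"
    then show "d x y \<le> 2 * (B + C)"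
      using tri[of x id y] sym[of x id] bound[of x] bound[of y] id_G
      by (auto simp: len_def gens_def)
  qed
qed

lemma word_in_carrier:
  assumes "set ws \<subseteq> gens"
  shows "foldr (\<otimes>\<^bsub>G\<^esub>) ws \<one>\<^bsub>G\<^esub> \<in> generate G gens"
    and "foldr (\<otimes>\<^bsub>G\<^esub>) ws \<one>\<^bsub>G\<^esub> \<in> carrier G"
    and "\<bar>translation (foldr (\<otimes>\<^bsub>G\<^esub>) ws \<one>\<^bsub>G\<^esub>)\<bar> \<le> length ws"
proof -
  have "foldr (\<otimes>\<^bsub>G\<^esub>) ws \<one>\<^bsub>G\<^esub> \<in> generate G gens \<and> foldr (\<otimes>\<^bsub>G\<^esub>) ws \<one>\<^bsub>G\<^esub> \<in> carrier G
      \<and> \<bar>translation (foldr (\<otimes>\<^bsub>G\<^esub>) ws \<one>\<^bsub>G\<^esub>)\<bar> \<le> length ws"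
    using assms
  proof (induction ws)
    case Nil
    then show ?case
      using generate.one[of G gens] G.one_closed translation_one by (simp del: G_simps)
  next
    case (Cons s ws)
    define w where "w = foldr (\<otimes>\<^bsub>G\<^esub>) ws \<one>\<^bsub>G\<^esub>"
    have s: "s \<in> gens" "s \<in> carrier G" "\<bar>translation s\<bar> \<le> 1"
      using Cons.prems by (auto simp: gens_def)
    have w: "w \<in> generate G gens" "w \<in> carrier G" "\<bar>translation w\<bar> \<le> length ws"
      using Cons.IH Cons.prems unfolding w_def set_simps insert_subset by blast+
    have "foldr (\<otimes>\<^bsub>G\<^esub>) (s # ws) \<one>\<^bsub>G\<^esub> = s \<otimes>\<^bsub>G\<^esub> w"
      unfolding w_def by (simp only: foldr.simps comp_apply)
    moreover have "\<bar>translation (s \<otimes>\<^bsub>G\<^esub> w)\<bar> \<le> length (s # ws)"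
      using s w by (simp add: translation_comp)
    ultimately show ?case
      using generate.eng[OF generate.incl[OF s(1)] w(1)] G.m_closed[OF s(2) w(2)] by metis
  qed
  then show "foldr (\<otimes>\<^bsub>G\<^esub>) ws \<one>\<^bsub>G\<^esub> \<in> generate G gens"
    and "foldr (\<otimes>\<^bsub>G\<^esub>) ws \<one>\<^bsub>G\<^esub> \<in> carrier G"
    and "\<bar>translation (foldr (\<otimes>\<^bsub>G\<^esub>) ws \<one>\<^bsub>G\<^esub>)\<bar> \<le> length ws" by blast+
qed

text \<open>The word consists of unit translations and one element of the wreath product, which is itself a
generator; this additional letter is the error 1 in the comparison of the word length with
\<open>\<bar>translation g\<bar>\<close>.\<close>

lemma word_exists:
  assumes "g \<in> carrier G"
  shows "\<exists>ws. length ws = nat \<bar>translation g\<bar> + 1 \<and> set ws \<subseteq> gens \<and> foldr (\<otimes>\<^bsub>G\<^esub>) ws \<one>\<^bsub>G\<^esub> = g"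
proof -
  obtain z c \<sigma> where g: "wreath_data c \<sigma>" "g = wreath_elt z c \<sigma>"
    using assms by (auto elim: in_carrier_cases)
  let ?t = "wreath_elt (sgn z) (\<lambda>_. id) id"
  have pow: "foldr (\<circ>) (replicate k ?t) (wreath_elt 0 c \<sigma>) = wreath_elt (int k * sgn z) c \<sigma>" for k
  proof (induction k)
    case (Suc k)
    have "foldr (\<circ>) (replicate (Suc k) ?t) (wreath_elt 0 c \<sigma>) = ?t \<circ> wreath_elt (int k * sgn z) c \<sigma>"
      by (simp only: replicate_Suc foldr.simps comp_apply Suc)
    also have "\<dots> = wreath_elt (int (Suc k) * sgn z) c \<sigma>"
      by (simp add: wreath_elt_comp g(1) algebra_simps)
    finally show ?case .
  qed simp
  show ?thesis
  proof (intro exI[of _ "replicate (nat \<bar>z\<bar>) ?t @ [wreath_elt 0 c \<sigma>]"] conjI)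
    show "set (replicate (nat \<bar>z\<bar>) ?t @ [wreath_elt 0 c \<sigma>]) \<subseteq> gens"
      using g(1) by (auto simp: gens_def wreath_elt_in_carrier sgn_if)
    have "(\<otimes>\<^bsub>G\<^esub>) = (\<circ>)"
      by (simp add: fun_eq_iff)
    then show "foldr (\<otimes>\<^bsub>G\<^esub>) (replicate (nat \<bar>z\<bar>) ?t @ [wreath_elt 0 c \<sigma>]) \<one>\<^bsub>G\<^esub> = g"
      using pow[of "nat \<bar>z\<bar>"] g(2) by (simp add: abs_mult_sgn)
  qed (simp add: g)
qed

lemma word_generating_set_gens: "word_generating_set G (pointwise_topology G) gens"
  unfolding word_generating_set_def
proof (intro conjI ballI closedin_gens coarsely_bounded_gens)
  show "inv\<^bsub>G\<^esub> s \<in> gens" if "s \<in> gens" for s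
    using that by (simp add: gens_def translation_inv)
  show "generate G gens = carrier G"
  proof
    show "generate G gens \<subseteq> carrier G"
      by (rule G.generate_incl) (auto simp: gens_def)
    show "carrier G \<subseteq> generate G gens"
      using word_exists word_in_carrier(1) by blast
  qed
qed

lemma word_length_approx:
  assumes "g \<in> carrier G"
  shows "\<bar>real (word_length G gens g) - \<bar>real_of_int (translation g)\<bar>\<bar> \<le> 1"
proof -
  let ?P = "\<lambda>n. \<exists>ws. length ws = n \<and> set ws \<subseteq> gens \<and> foldr (\<otimes>\<^bsub>G\<^esub>) ws \<one>\<^bsub>G\<^esub> = g"
  have P: "?P (nat \<bar>translation g\<bar> + 1)"
    by (rule word_exists[OF assms])
  have "word_length G gens g \<le> nat \<bar>translation g\<bar> + 1"
    unfolding word_length_def by (rule Least_le[of ?P, OF P])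
  moreover have "?P (word_length G gens g)"
    unfolding word_length_def by (rule LeastI[of ?P, OF P])
  then obtain ws where ws: "length ws = word_length G gens g" "set ws \<subseteq> gens"
    "foldr (\<otimes>\<^bsub>G\<^esub>) ws \<one>\<^bsub>G\<^esub> = g" by blast
  have "\<bar>translation g\<bar> \<le> int (word_length G gens g)"
    using word_in_carrier(3)[OF ws(2)] unfolding ws(1,3) .
  ultimately show ?thesis by linarith
qed

sublocale quasi_line "carrier G" "word_dist G gens" "\<lambda>g. real_of_int (translation g)" "\<one>\<^bsub>G\<^esub>"
proof
  fix x y assume "x \<in> carrier G" "y \<in> carrier G"
  then have "inv\<^bsub>G\<^esub> x \<otimes>\<^bsub>G\<^esub> y \<in> carrier G" "translation (inv\<^bsub>G\<^esub> x \<otimes>\<^bsub>G\<^esub> y) = translation y - translation x"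
    using translation_comp[of "inv\<^bsub>G\<^esub> x" y] by (simp_all add: translation_inv del: G_simps) (simp add: translation_inv)
  then show "\<bar>word_dist G gens x y - \<bar>real_of_int (translation x) - real_of_int (translation y)\<bar>\<bar> \<le> 1"
    using word_length_approx[of "inv\<^bsub>G\<^esub> x \<otimes>\<^bsub>G\<^esub> y"] unfolding word_dist_def by simp
qed (use G.one_closed translation_one in auto)

lemma upper_end_nonempty: "upper_end \<noteq> {}"
proof -
  have "filterlim (\<lambda>i. real i) at_top sequentially"
    by (rule filterlim_real_sequentially)
  then have "(\<lambda>i. wreath_elt (int i) (\<lambda>_. id) id) \<in> upper_end"
    by (auto simp: upper_end_def wreath_elt_in_carrier)
  then show ?thesis by blast
qed

text \<open>Left multiplication by \<open>g\<close> changes all translation numbers by the same amount, so it preserves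
divergence to \<open>\<infinity>\<close>.\<close>

lemma boundary_action_upper_end:
  assumes g: "g \<in> carrier G"
  shows "boundary_action G g upper_end = upper_end"
proof -
  have maps: "(\<lambda>i. h \<otimes>\<^bsub>G\<^esub> x i) \<in> upper_end" if h: "h \<in> carrier G" and x: "x \<in> upper_end" for h x
  proof -
    have xG: "x i \<in> carrier G" for i
      using x by (auto simp: upper_end_def)
    have "filterlim (\<lambda>i. real_of_int (translation h) + real_of_int (translation (x i))) at_top sequentially"
      using x by (intro filterlim_tendsto_add_at_top[OF tendsto_const]) (simp add: upper_end_def)
    then show ?thesis
      using xG h G.m_closed[OF h xG] by (auto simp: upper_end_def translation_comp)
  qed
  show ?thesis
  proof
    show "boundary_action G g upper_end \<subseteq> upper_end"
      using maps[OF g] by (auto simp: boundary_action_def)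
    show "upper_end \<subseteq> boundary_action G g upper_end"
    proof
      fix y assume y: "y \<in> upper_end"
      then have yG: "y i \<in> carrier G" for i
        by (auto simp: upper_end_def)
      have "y = (\<lambda>i. g \<otimes>\<^bsub>G\<^esub> (inv\<^bsub>G\<^esub> g \<otimes>\<^bsub>G\<^esub> y i))"
        using g yG G.m_assoc[of g "inv\<^bsub>G\<^esub> g"] G.r_inv[OF g] by (simp del: G_simps)
      then show "y \<in> boundary_action G g upper_end"
        unfolding boundary_action_def using maps[OF G.inv_closed[OF g] y] by (rule image_eqI)
    qed
  qed
qed

lemma stabilizer_upper_end: "stabilizer G (boundary_action G) upper_end = carrier G"
  using boundary_action_upper_end by (auto simp: stabilizer_def)

end

section \<open>Amenability and actions on arbitrary compact spaces\<close>

lemma continuous_map_borel_measurable: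
  assumes "continuous_map X Y f"
    and M: "sets M = sets (sigma (topspace X) {U. openin X U})"
    and N: "sets N = sets (sigma (topspace Y) {U. openin Y U})"
  shows "f \<in> measurable M N"
proof -
  have M_eq: "sets M = sigma_sets (topspace X) {U. openin X U}"
    unfolding M by (rule sets_measure_of) (auto dest: openin_subset)
  have space_M: "space M = topspace X"
    using sets_eq_imp_space_eq[OF M] by (simp add: space_measure_of_conv)
  have "f \<in> measurable M (sigma (topspace Y) {U. openin Y U})"
  proof (rule measurable_measure_of)
    show "f -` U \<inter> space M \<in> sets M" if "U \<in> {U. openin Y U}" for U
    proof -
      have "openin X {x \<in> topspace X. f x \<in> U}"
        using that assms(1) by (intro openin_continuous_map_preimage) auto
      moreover have "{x \<in> topspace X. f x \<in> U} = f -` U \<inter> space M"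
        by (auto simp: space_M)
      ultimately show ?thesis
        unfolding M_eq by (auto intro: sigma_sets.Basic)
    qed
    show "f \<in> space M \<rightarrow> topspace Y"
      using assms(1) by (auto simp: space_M continuous_map_def)
  qed (auto dest: openin_subset)
  then show ?thesis
    by (simp add: measurable_cong_sets[OF refl N])
qed

lemma continuous_action_continuous_map:
  assumes "continuous_action H T X \<phi>" "g \<in> topspace T"
  shows "continuous_map X X (\<phi> g)"
proof -
  have "continuous_map X (prod_topology T X) (\<lambda>x. (g, x))"
    using assms(2) by (simp add: continuous_map_pairwise o_def)
  then have "continuous_map X X ((\<lambda>(g, x). \<phi> g x) \<circ> (\<lambda>x. (g, x)))"
    using assms(1) by (intro continuous_map_compose) (auto simp: continuous_action_def)
  then show ?thesis
    by (simp add: o_def)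
qed

text \<open>Amenability is defined with compact spaces whose points are sets of sets of group elements. An
action on a compact space of any other type can be transported along an injection \<open>\<iota>\<close>, and the
invariant measure is pushed back along its inverse \<open>f\<close>.\<close>

lemma amenable_invariant_measure:
  fixes H :: "('g, 'b) monoid_scheme" and Y :: "'x topology" and \<iota> :: "'x \<Rightarrow> 'g set set"
  assumes "amenable H T" and topspace_T: "topspace T = carrier H" and inj: "inj_on \<iota> (topspace Y)"
    and compact: "compact_space Y" and Hausdorff: "Hausdorff_space Y" and nonempty: "topspace Y \<noteq> {}"
    and act: "continuous_action H T Y \<phi>"
  shows "\<exists>M. prob_space M \<and> sets M = sets (sigma (topspace Y) {U. openin Y U}) \<and>
    (\<forall>g\<in>carrier H. distr M M (\<phi> g) = M)"
proof -
  define E where "E = \<iota> ` topspace Y"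
  define f where "f = inv_into (topspace Y) \<iota>"
  define Y' where "Y' = pullback_topology E f Y"
  define \<psi> where "\<psi> g = restrict (\<iota> \<circ> \<phi> g \<circ> f) E" for g
  have f\<iota> [simp]: "f (\<iota> x) = x" if "x \<in> topspace Y" for x
    using inj that by (simp add: f_def)
  have fE: "f y \<in> topspace Y" "\<iota> (f y) = y" if "y \<in> E" for y
    using that by (auto simp: E_def)
  have top': "topspace Y' = E"
    using fE by (auto simp: Y'_def topspace_pullback_topology)
  have cont_f: "continuous_map Y' Y f"
    using continuous_map_pullback[OF continuous_map_id, of E f Y] by (simp add: Y'_def)
  have cont_\<iota>: "continuous_map Z Y' (\<iota> \<circ> k)" if "continuous_map Z Y k" for Z :: "'z topology" and k
    unfolding Y'_def
  proof (rule continuous_map_pullback')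
    have "k z \<in> topspace Y" if "z \<in> topspace Z" for z
      using \<open>continuous_map Z Y k\<close> that by (auto simp: continuous_map_def)
    then show "topspace Z \<subseteq> (\<iota> \<circ> k) -` E" "continuous_map Z Y (f \<circ> (\<iota> \<circ> k))"
      using continuous_map_eq[OF that, of "f \<circ> (\<iota> \<circ> k)"] by (auto simp: E_def)
  qed
  have "homeomorphic_maps Y Y' \<iota> f"
    using cont_\<iota>[OF continuous_map_id] cont_f fE by (auto simp: homeomorphic_maps_def top')
  then have homeo: "Y homeomorphic_space Y'"
    unfolding homeomorphic_space_def by blast
  interpret act: group_action H "topspace Y" \<phi>
    using act by (simp add: continuous_action_def)
  have act': "continuous_action H T Y' \<psi>"
    unfolding continuous_action_def
  proof
    have \<psi>_Bij: "\<psi> g \<in> Bij E" if "g \<in> carrier H" for g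
    proof -
      have b: "bij_betw (\<phi> g) (topspace Y) (topspace Y)"
        using act.bij_prop0[OF that] by (simp add: Bij_def)
      have "bij_betw \<iota> (topspace Y) E" "bij_betw f E (topspace Y)"
        using inj unfolding E_def f_def by (auto intro: bij_betw_inv_into inj_on_imp_bij_betw)
      then have "bij_betw (\<iota> \<circ> \<phi> g \<circ> f) E E"
        using b by (meson bij_betw_trans)
      then show ?thesis
        by (simp add: Bij_def \<psi>_def)
    qed
    have "\<psi> (g \<otimes>\<^bsub>H\<^esub> h) = compose E (\<psi> g) (\<psi> h)" if "g \<in> carrier H" "h \<in> carrier H" for g h
    proof
      fix y
      show "\<psi> (g \<otimes>\<^bsub>H\<^esub> h) y = compose E (\<psi> g) (\<psi> h) y"
      proof (cases "y \<in> E")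
        case True
        then have "\<phi> h (f y) \<in> topspace Y" "\<phi> (g \<otimes>\<^bsub>H\<^esub> h) (f y) = \<phi> g (\<phi> h (f y))"
          using act.element_image[OF that(2)] act.composition_rule[OF _ that] fE by auto
        then show ?thesis
          using True by (auto simp: \<psi>_def compose_def E_def)
      qed (simp add: \<psi>_def compose_def)
    qed
    then show "group_action H (topspace Y') \<psi>"
      unfolding top' group_action_def group_hom_def group_hom_axioms_def
      using \<psi>_Bij act.group_hom by (auto simp: hom_def BijGroup_def group_hom_def group_BijGroup[unfolded BijGroup_def])
  next
    have "continuous_map (prod_topology T Y') (prod_topology T Y) (\<lambda>(g, y). (g, f y))"
      using cont_f by (simp add: continuous_map_prod_top)
    then have "continuous_map (prod_topology T Y') Y ((\<lambda>(g, x). \<phi> g x) \<circ> (\<lambda>(g, y). (g, f y)))"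
      using act by (intro continuous_map_compose) (auto simp: continuous_action_def)
    from cont_\<iota>[OF this]
    show "continuous_map (prod_topology T Y') Y' (\<lambda>(g, y). \<psi> g y)"
      by (rule continuous_map_eq) (auto simp: \<psi>_def top')
  qed
  have "compact_space Y'" "Hausdorff_space Y'" "topspace Y' \<noteq> {}"
    using homeomorphic_compact_space[OF homeo] homeomorphic_Hausdorff_space[OF homeo] compact Hausdorff nonempty
    by (auto simp: top' E_def)
  with act' have "\<exists>M. regular_borel_prob Y' M \<and> (\<forall>g\<in>carrier H. distr M M (\<psi> g) = M)"
    by (intro \<open>amenable H T\<close>[unfolded amenable_def, rule_format] conjI)
  then obtain M where M: "regular_borel_prob Y' M" "\<And>g. g \<in> carrier H \<Longrightarrow> distr M M (\<psi> g) = M"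
    by blast
  define B where "B = sigma (topspace Y) {U. openin Y U}"
  have sets_M: "sets M = sets (sigma E {U. openin Y' U})" and "prob_space M"
    using M(1) by (auto simp: regular_borel_prob_def top')
  have space_M: "space M = E"
    using sets_eq_imp_space_eq[OF sets_M] by (simp add: space_measure_of_conv)
  have f_meas: "f \<in> measurable M B"
    by (rule continuous_map_borel_measurable[OF cont_f]) (simp_all add: sets_M B_def top')
  have \<phi>_meas: "\<phi> g \<in> measurable B B" if "g \<in> carrier H" for g
    using that topspace_T unfolding B_def
    by (intro continuous_map_borel_measurable[OF continuous_action_continuous_map[OF act]]) auto
  have \<psi>_meas: "\<psi> g \<in> measurable M M" if "g \<in> carrier H" for g
    using that topspace_T
    by (intro continuous_map_borel_measurable[OF continuous_action_continuous_map[OF act']])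
      (simp_all add: sets_M top')
  have "distr (distr M B f) (distr M B f) (\<phi> g) = distr M B f" if g: "g \<in> carrier H" for g
  proof -
    have "distr (distr M B f) (distr M B f) (\<phi> g) = distr (distr M B f) B (\<phi> g)"
      by (rule distr_cong) simp_all
    also have "\<dots> = distr M B (\<phi> g \<circ> f)"
      by (rule distr_distr[OF \<phi>_meas[OF g] f_meas])
    also have "\<dots> = distr M B (f \<circ> \<psi> g)"
    proof (rule distr_cong)
      fix y assume "y \<in> space M"
      then have "\<phi> g (f y) \<in> topspace Y"
        using act.element_image[OF g] fE by (auto simp: space_M)
      then show "(\<phi> g \<circ> f) y = (f \<circ> \<psi> g) y"
        using \<open>y \<in> space M\<close> by (simp add: \<psi>_def space_M)
    qed simp_all
    also have "\<dots> = distr (distr M M (\<psi> g)) B f"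
      by (rule distr_distr[OF f_meas \<psi>_meas[OF g], symmetric])
    finally show ?thesis
      by (simp add: M(2)[OF g])
  qed
  moreover have "prob_space (distr M B f)"
    using \<open>prob_space M\<close> f_meas by (rule prob_space.prob_space_distr)
  ultimately show ?thesis
    by (intro exI[of _ "distr M B f"]) (simp add: B_def)
qed

section \<open>An invariant measure for the base group\<close>

locale compact_transformation_group = countable_transformation_group F
  for F :: "('x::topological_space \<Rightarrow> 'x) set" +
  assumes compact_UNIV: "compact (UNIV :: 'x set)"
    and Hausdorff: "Hausdorff_space (euclidean :: 'x topology)"
    and continuous_F: "\<And>f. f \<in> F \<Longrightarrow> continuous_on UNIV f"
begin

interpretation G: topological_group G "pointwise_topology G"
  unfolding G_def by (rule topological_group_sym_centralizer)

text \<open>Restricting a map to the points \<open>orbit_pt n id\<close> identifies the equivariant maps with \<open>X\<^sup>\<nat>\<close>, up to the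
unconstrained values on the line. In this form the group acts simply by precomposition with the inverse.\<close>

definition equivariant_maps :: "(nat \<Rightarrow> 'x) set" where
  "equivariant_maps = {m. \<forall>n. \<forall>h\<in>F. m (orbit_pt n h) = h (m (orbit_pt n id))}"

definition translate :: "(nat \<Rightarrow> nat) \<Rightarrow> (nat \<Rightarrow> 'x) \<Rightarrow> nat \<Rightarrow> 'x" where
  "translate g = restrict (\<lambda>m. m \<circ> inv\<^bsub>G\<^esub> g) equivariant_maps"

lemma continuous_on_coordinate: "continuous_on A (\<lambda>m::nat \<Rightarrow> 'x. m w)"
  by (rule continuous_on_subset[OF continuous_on_product_coordinates subset_UNIV])

lemma compact_equivariant_maps: "compact equivariant_maps"
proof -
  have "compact_space (euclidean :: 'x topology)"
    using compact_UNIV by (simp add: compact_space_def)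
  then have "compact_space (euclidean :: (nat \<Rightarrow> 'x) topology)"
    by (simp add: compact_space_product_topology flip: euclidean_product_topology)
  then have "compact (UNIV :: (nat \<Rightarrow> 'x) set)"
    by (simp add: compact_space_def)
  moreover have "closed {m. m (orbit_pt n h) = h (m (orbit_pt n id))}" if "h \<in> F" for n h
  proof -
    have "continuous_on UNIV (\<lambda>m. h (m (orbit_pt n id)))"
      by (rule continuous_on_compose2[OF continuous_F[OF that] continuous_on_coordinate]) simp
    then have "closedin euclidean {m \<in> topspace euclidean. m (orbit_pt n h) = h (m (orbit_pt n id))}"
      by (intro closedin_continuous_maps_eq[OF Hausdorff])
        (simp_all only: continuous_map_iff_continuous2 continuous_on_coordinate)
    then show ?thesis
      unfolding closed_closedin topspace_euclidean by (simp only: UNIV_I simp_thms)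
  qed
  then have "closed (\<Inter>n. \<Inter>h\<in>F. {m. m (orbit_pt n h) = h (m (orbit_pt n id))})"
    by (intro closed_INT ballI)
  moreover have "equivariant_maps = (\<Inter>n. \<Inter>h\<in>F. {m. m (orbit_pt n h) = h (m (orbit_pt n id))})"
    by (auto simp: equivariant_maps_def)
  ultimately show ?thesis
    using compact_Int_closed by fastforce
qed

lemma equivariant_maps_nonempty: "equivariant_maps \<noteq> {}"
proof -
  have "(\<lambda>w. case inv_into points (to_nat_on points) w of Inl y \<Rightarrow> undefined | Inr (n, h) \<Rightarrow> h undefined)
      \<in> equivariant_maps"
    by (simp add: equivariant_maps_def)
  then show ?thesis by blast
qed

lemma equivariantD:
  "m \<in> equivariant_maps \<Longrightarrow> h \<in> F \<Longrightarrow> m (orbit_pt n h) = h (m (orbit_pt n id))"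
  unfolding equivariant_maps_def by blast

lemma translate_closed:
  assumes "g \<in> carrier G" "m \<in> equivariant_maps"
  shows "translate g m \<in> equivariant_maps"
proof -
  obtain z c \<sigma> where g: "wreath_data c \<sigma>" "inv\<^bsub>G\<^esub> g = wreath_elt z c \<sigma>"
    by (rule in_carrier_cases[OF G.inv_closed[OF assms(1)]])
  note m = equivariantD[OF assms(2)]
  have "m (wreath_elt z c \<sigma> (orbit_pt n h)) = h (m (wreath_elt z c \<sigma> (orbit_pt n id)))" if "h \<in> F" for n h
  proof -
    have "wreath_elt z c \<sigma> (orbit_pt n h) = orbit_pt (\<sigma> n) (h \<circ> c n)"
      "wreath_elt z c \<sigma> (orbit_pt n id) = orbit_pt (\<sigma> n) (c n)" and cF: "c n \<in> F"
      using that g(1) by simp_all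
    moreover have "m (orbit_pt (\<sigma> n) (h \<circ> c n)) = h (c n (m (orbit_pt (\<sigma> n) id)))"
      by (subst m) (use that cF in simp_all)
    moreover have "m (orbit_pt (\<sigma> n) (c n)) = c n (m (orbit_pt (\<sigma> n) id))"
      by (rule m[OF cF])
    ultimately show ?thesis by (simp only:)
  qed
  moreover have "translate g m = m \<circ> wreath_elt z c \<sigma>"
    using assms(2) by (simp add: translate_def g(2))
  ultimately show ?thesis
    unfolding equivariant_maps_def mem_Collect_eq comp_apply by (simp only: comp_apply) blast
qed

lemma translate_mult:
  assumes "g \<in> carrier G" "h \<in> carrier G" "m \<in> equivariant_maps"
  shows "translate (g \<otimes>\<^bsub>G\<^esub> h) m = translate g (translate h m)"
  using assms translate_closed[OF assms(2,3)] G.inv_mult_group[OF assms(1,2)]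
  by (simp add: translate_def comp_assoc)

lemma translate_one:
  assumes "m \<in> equivariant_maps"
  shows "translate \<one>\<^bsub>G\<^esub> m = m"
proof -
  have "translate \<one>\<^bsub>G\<^esub> m = m \<circ> inv\<^bsub>G\<^esub> \<one>\<^bsub>G\<^esub>"
    using assms by (simp add: translate_def)
  also have "\<dots> = m"
    unfolding G.inv_one by simp
  finally show ?thesis .
qed

lemma group_action_translate: "group_action G equivariant_maps translate"
proof -
  have bij: "translate g \<in> Bij equivariant_maps" if g: "g \<in> carrier G" for g
  proof -
    have "bij_betw (translate g) equivariant_maps equivariant_maps"
    proof (rule bij_betwI[where g = "translate (inv\<^bsub>G\<^esub> g)"])
      fix m assume m: "m \<in> equivariant_maps"
      show "translate (inv\<^bsub>G\<^esub> g) (translate g m) = m" "translate g (translate (inv\<^bsub>G\<^esub> g) m) = m"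
        using translate_mult[OF _ _ m, of "inv\<^bsub>G\<^esub> g" g] translate_mult[OF _ _ m, of g "inv\<^bsub>G\<^esub> g"]
          translate_one[OF m] g G.inv_closed[OF g] G.l_inv[OF g] G.r_inv[OF g] by metis+
    qed (use g translate_closed in auto)
    then show ?thesis
      by (simp add: Bij_def translate_def)
  qed
  have hom: "translate (g \<otimes>\<^bsub>G\<^esub> h) = compose equivariant_maps (translate g) (translate h)"
    if "g \<in> carrier G" "h \<in> carrier G" for g h
  proof
    fix m
    show "translate (g \<otimes>\<^bsub>G\<^esub> h) m = compose equivariant_maps (translate g) (translate h) m"
    proof (cases "m \<in> equivariant_maps")
      case True
      then show ?thesis
        using translate_mult[OF that True] by (simp add: compose_def)
    next
      case False
      then show ?thesis
        by (simp add: compose_def translate_def)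
    qed
  qed
  have "translate \<in> hom G (BijGroup equivariant_maps)"
    unfolding hom_def BijGroup_def using bij hom by simp
  then show ?thesis
    unfolding group_action_def group_hom_def group_hom_axioms_def
    by (simp add: group_BijGroup G.group_axioms)
qed

text \<open>The value at \<open>w\<close> of the translate of \<open>m\<close> by \<open>g\<close> is the value of \<open>m\<close> at a point that is locally constant
in \<open>g\<close>, so it is jointly continuous.\<close>

lemma continuous_action_translate:
  "continuous_action G (pointwise_topology G) (top_of_set equivariant_maps) translate"
proof -
  let ?D = "carrier G \<times> equivariant_maps"
  have "continuous_on ?D (\<lambda>(g, m). m \<circ> inv\<^bsub>G\<^esub> g)"
  proof (rule continuous_on_coordinatewise_then_product)
    fix w
    show "continuous_on ?D (\<lambda>p. (case p of (g, m) \<Rightarrow> m \<circ> inv\<^bsub>G\<^esub> g) w)"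
      unfolding continuous_on_def
    proof clarify
      fix g m assume gm: "g \<in> carrier G" "m \<in> equivariant_maps"
      \<comment> \<open>Near \<open>g\<close> the point \<open>inv g w\<close> does not move, so only the continuity of evaluation matters.\<close>
      have "continuous_on ?D (\<lambda>p. snd p ((inv\<^bsub>G\<^esub> g) w))"
        by (rule continuous_on_product_then_coordinatewise[OF continuous_on_snd[OF continuous_on_id]])
      then have lim: "((\<lambda>p. snd p ((inv\<^bsub>G\<^esub> g) w)) \<longlongrightarrow> m ((inv\<^bsub>G\<^esub> g) w)) (at (g, m) within ?D)"
        using gm by (fastforce simp: continuous_on_def)
      have "\<forall>\<^sub>F h in nhds g. bij h \<longrightarrow> inv_into UNIV h w = inv_into UNIV g w"
        using gm by (intro eventually_inv_eq) (simp add: G_def in_sym_centralizer)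
      then have "\<forall>\<^sub>F h in nhds g. h \<in> carrier G \<longrightarrow> (inv\<^bsub>G\<^esub> h) w = (inv\<^bsub>G\<^esub> g) w"
        using gm by (auto elim!: eventually_mono simp: G_def sym_centralizer_inv in_sym_centralizer)
      then have "\<forall>\<^sub>F p in nhds g \<times>\<^sub>F nhds m. fst p \<in> carrier G \<longrightarrow> (inv\<^bsub>G\<^esub> (fst p)) w = (inv\<^bsub>G\<^esub> g) w"
        by (rule eventually_prodI[OF _ eventually_True, THEN eventually_mono]) simp
      then have "\<forall>\<^sub>F p in at (g, m) within ?D.
          snd p ((inv\<^bsub>G\<^esub> g) w) = (case p of (g, m) \<Rightarrow> m \<circ> inv\<^bsub>G\<^esub> g) w"
        unfolding nhds_prod[symmetric] eventually_at_filter by (auto elim!: eventually_mono)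
      from Lim_transform_eventually[OF lim this]
      show "((\<lambda>p. (case p of (g, m) \<Rightarrow> m \<circ> inv\<^bsub>G\<^esub> g) w) \<longlongrightarrow> (m \<circ> inv\<^bsub>G\<^esub> g) w) (at (g, m) within ?D)"
        by simp
    qed
  qed
  then have "continuous_on ?D (\<lambda>(g, m). translate g m)"
    by (rule continuous_on_eq) (auto simp: translate_def)
  then have "continuous_map (top_of_set ?D) (top_of_set equivariant_maps) (\<lambda>(g, m). translate g m)"
    using translate_closed by (intro continuous_map_into_subtopology) auto
  then show ?thesis
    unfolding continuous_action_def pointwise_topology_def
    using group_action_translate by (simp flip: subtopology_Times)
qed

text \<open>Evaluation at the point \<open>orbit_pt 0 id\<close> intertwines the action of the element of the base group that
is constantly \<open>f\<close>, up to inversion, with the map \<open>f\<close> on \<open>X\<close>. So it pushes an invariant measure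
forward to one that is invariant under \<open>F\<close>.\<close>

theorem not_amenable:
  fixes \<iota> :: "(nat \<Rightarrow> 'x) \<Rightarrow> (nat \<Rightarrow> nat) set set"
  assumes "inj \<iota>"
    and no_invariant: "\<nexists>\<mu>. prob_space \<mu> \<and> sets \<mu> = sets borel \<and> (\<forall>f\<in>F. distr \<mu> borel f = \<mu>)"
  shows "\<not> amenable G (pointwise_topology G)"
proof
  let ?Y = "top_of_set equivariant_maps"
  assume "amenable G (pointwise_topology G)"
  moreover have "inj_on \<iota> (topspace ?Y)"
    using \<open>inj \<iota>\<close> by (meson inj_on_subset subset_UNIV)
  moreover have "compact_space ?Y" "topspace ?Y \<noteq> {}"
    using compact_equivariant_maps equivariant_maps_nonempty
    by (auto simp: compact_space_subtopology)
  moreover have "Hausdorff_space ?Y"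
  proof (rule Hausdorff_space_subtopology)
    show "Hausdorff_space (euclidean :: (nat \<Rightarrow> 'x) topology)"
      using Hausdorff
      by (simp add: Hausdorff_space_product_topology flip: euclidean_product_topology)
  qed
  ultimately obtain M where "prob_space M"
    and M: "sets M = sets (sigma (topspace ?Y) {U. openin ?Y U})"
    and inv: "\<And>g. g \<in> carrier G \<Longrightarrow> distr M M (translate g) = M"
    using amenable_invariant_measure[OF _ G.topspace_eq, of \<iota> ?Y translate]
      continuous_action_translate by metis
  have space_M: "space M = equivariant_maps"
    using sets_eq_imp_space_eq[OF M] by (simp add: space_measure_of_conv)
  define ev where "ev m = m (orbit_pt 0 id)" for m :: "nat \<Rightarrow> 'x"
  have ev_meas: "ev \<in> measurable M borel"
    by (rule continuous_map_borel_measurable[OF _ M, of euclidean])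
      (simp_all add: ev_def[abs_def] continuous_on_coordinate borel_def)
  have "distr (distr M borel ev) borel f = distr M borel ev" if f: "f \<in> F" for f
  proof -
    define k where "k = wreath_elt 0 (\<lambda>_. f) id"
    have k: "k \<in> carrier G"
      using f by (simp add: k_def wreath_elt_in_carrier wreath_data_def)
    have "translate (inv\<^bsub>G\<^esub> k) \<in> measurable M M"
      using k G.inv_closed[OF k] G.topspace_eq
      by (intro continuous_map_borel_measurable[OF continuous_action_continuous_map[OF continuous_action_translate] M M])
        simp
    note t_meas = this
    have f_meas: "f \<in> measurable borel borel"
      using continuous_F[OF f] by (rule borel_measurable_continuous_onI)
    have "distr (distr M borel ev) borel f = distr M borel (f \<circ> ev)"
      by (rule distr_distr[OF f_meas ev_meas])
    also have "\<dots> = distr M borel (ev \<circ> translate (inv\<^bsub>G\<^esub> k))"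
    proof (rule distr_cong)
      fix m assume "m \<in> space M"
      then have m: "m \<in> equivariant_maps"
        by (simp add: space_M)
      then have "ev (translate (inv\<^bsub>G\<^esub> k) m) = m (k (orbit_pt 0 id))"
        using k by (simp add: ev_def translate_def)
      also have "\<dots> = f (ev m)"
        using f equivariantD[OF m f, of 0] by (simp add: k_def ev_def)
      finally show "(f \<circ> ev) m = (ev \<circ> translate (inv\<^bsub>G\<^esub> k)) m"
        by simp
    qed simp_all
    also have "\<dots> = distr (distr M M (translate (inv\<^bsub>G\<^esub> k))) borel ev"
      by (rule distr_distr[OF ev_meas t_meas, symmetric])
    also have "\<dots> = distr M borel ev"
      using inv[OF G.inv_closed[OF k]] by simp
    finally show ?thesis .
  qed
  moreover have "prob_space (distr M borel ev)"
    using \<open>prob_space M\<close> ev_meas by (rule prob_space.prob_space_distr)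
  ultimately have "prob_space (distr M borel ev) \<and> sets (distr M borel ev) = sets borel \<and>
      (\<forall>f\<in>F. distr (distr M borel ev) borel f = distr M borel ev)"
    by (intro conjI ballI sets_distr)
  then show False
    using no_invariant by blast
qed

end

section \<open>Homeomorphisms of the Cantor space without invariant measure\<close>

text \<open>For a set of involutions this is the group that they generate.\<close>

inductive_set composites :: "('x \<Rightarrow> 'x) set \<Rightarrow> ('x \<Rightarrow> 'x) set" for I where
  id: "id \<in> composites I"
| comp: "f \<in> I \<Longrightarrow> h \<in> composites I \<Longrightarrow> f \<circ> h \<in> composites I"

lemma composites_trans:
  assumes "f \<in> composites I" "h \<in> composites I"
  shows "f \<circ> h \<in> composites I"
  using assms by induction (auto simp: comp_assoc intro: composites.comp)

lemma composites_involutions: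
  assumes "countable I" and inv: "\<And>f. f \<in> I \<Longrightarrow> f \<circ> f = id"
  shows "countable_transformation_group (composites I)"
proof
  have "f \<in> (\<lambda>ws. foldr (\<circ>) ws id) ` lists I" if "f \<in> composites I" for f
    using that
  proof induction
    case id
    have "id = foldr (\<circ>) [] id"
      by (simp only: foldr.simps id_apply)
    then show ?case by blast
  next
    case (comp f h)
    then obtain ws where "h = foldr (\<circ>) ws id" "ws \<in> lists I"
      by blast
    then have "f \<circ> h = foldr (\<circ>) (f # ws) id" "f # ws \<in> lists I"
      using comp by (simp_all only: foldr.simps comp_apply lists.Cons)
    then show ?case by blast
  qed
  then show "countable (composites I)"
    using \<open>countable I\<close> by (meson countable_image countable_lists countable_subset subsetI)
  show "\<exists>h\<in>composites I. h \<circ> f = id \<and> f \<circ> h = id" if "f \<in> composites I" for f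
    using that
  proof induction
    case id
    show ?case
      by (rule bexI[OF _ composites.id]) simp
  next
    case (comp f h)
    then obtain k where k: "k \<in> composites I" "k \<circ> h = id" "h \<circ> k = id"
      by blast
    have "k \<circ> f \<in> composites I"
      using composites_trans[OF k(1) composites.comp[OF comp(1) composites.id]] by simp
    moreover have "(k \<circ> f) \<circ> (f \<circ> h) = k \<circ> (f \<circ> f) \<circ> h" "(f \<circ> h) \<circ> (k \<circ> f) = f \<circ> (h \<circ> k) \<circ> f"
      by (simp_all only: comp_assoc)
    ultimately show ?case
      using k inv[OF comp(1)] by (metis comp_id)
  qed
qed (auto intro: composites.id composites_trans)

text \<open>The homeomorphism that exchanges \<open>0y\<close> and \<open>1by\<close> for all sequences \<open>y\<close> and fixes the other sequences.\<close>

definition swap_cylinder :: "bool \<Rightarrow> (nat \<Rightarrow> bool) \<Rightarrow> nat \<Rightarrow> bool" where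
  "swap_cylinder b x = (\<lambda>n.
     if \<not> x 0 then (if n = 0 then True else if n = 1 then b else x (n - 1))
     else if x 1 = b then n \<noteq> 0 \<and> x (n + 1)
     else x n)"

definition flip_first :: "(nat \<Rightarrow> bool) \<Rightarrow> nat \<Rightarrow> bool" where
  "flip_first x = x(0 := \<not> x 0)"

definition cantor_involutions :: "((nat \<Rightarrow> bool) \<Rightarrow> nat \<Rightarrow> bool) set" where
  "cantor_involutions = {swap_cylinder True, swap_cylinder False, flip_first}"

lemma cantor_involution:
  assumes "f \<in> cantor_involutions"
  shows "f \<circ> f = id"
proof -
  have "swap_cylinder b (swap_cylinder b x) n = x n" for b x n
    by (cases "x 0"; cases "x 1 = b"; cases n) (auto simp: swap_cylinder_def)
  then have "swap_cylinder b \<circ> swap_cylinder b = id" for b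
    by (simp add: fun_eq_iff)
  moreover have "flip_first \<circ> flip_first = id"
    by (simp add: fun_eq_iff flip_first_def)
  ultimately show ?thesis
    using assms unfolding cantor_involutions_def by blast
qed

lemma continuous_cantor_involution:
  assumes "f \<in> cantor_involutions"
  shows "continuous_on UNIV f"
proof (intro continuous_on_coordinatewise_then_product continuous_on_locally_constant)
  fix x :: "nat \<Rightarrow> bool" and n
  show "\<forall>\<^sub>F y in nhds x. y \<in> UNIV \<longrightarrow> f y n = f x n"
    using eventually_agreeing_below[of "n + 2" x]
  proof eventually_elim
    case (elim y)
    then have eqs: "y 0 = x 0" "y 1 = x 1" "y (n - 1) = x (n - 1)" "y n = x n" "y (n + 1) = x (n + 1)"
      by auto
    have "swap_cylinder b y n = swap_cylinder b x n" for b
      unfolding swap_cylinder_def eqs ..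
    moreover have "flip_first y n = flip_first x n"
      unfolding flip_first_def by (simp add: eqs)
    ultimately show ?case
      using assms unfolding cantor_involutions_def by blast
  qed
qed

text \<open>Invariance gives the cylinders of 0, 10 and 11 the same mass, and the cylinders of 0 and 1 the same
mass. The latter is the sum of the masses of 10 and 11, so all these masses vanish.\<close>

lemma no_invariant_probability_cantor:
  fixes \<mu> :: "(nat \<Rightarrow> bool) measure"
  assumes "prob_space \<mu>" and sets: "sets \<mu> = sets borel"
    and inv: "\<And>f. f \<in> cantor_involutions \<Longrightarrow> distr \<mu> borel f = \<mu>"
  shows False
proof -
  interpret prob_space \<mu> by fact
  have open_coord: "open {x::nat \<Rightarrow> bool. P (x 0) (x 1)}" for P
    unfolding open_subopen[of "{x::nat \<Rightarrow> bool. P (x 0) (x 1)}"]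
  proof
    fix x :: "nat \<Rightarrow> bool" assume "x \<in> {x. P (x 0) (x 1)}"
    then have "x \<in> {y. \<forall>i<2. y i = x i}" "{y. \<forall>i<2. y i = x i} \<subseteq> {x. P (x 0) (x 1)}"
      by auto
    then show "\<exists>T. open T \<and> x \<in> T \<and> T \<subseteq> {x. P (x 0) (x 1)}"
      using open_agreeing_below[of 2 x] by (intro exI[of _ "{y. \<forall>i<2. y i = x i}"] conjI)
  qed
  have meas: "{x. P (x 0) (x 1)} \<in> sets \<mu>" for P :: "bool \<Rightarrow> bool \<Rightarrow> bool"
    unfolding sets by (rule borel_open[OF open_coord])
  have space: "space \<mu> = UNIV"
    using sets_eq_imp_space_eq[OF sets] by simp
  have preserve: "measure \<mu> (f -` {x. P (x 0) (x 1)}) = measure \<mu> {x. P (x 0) (x 1)}"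
    if "f \<in> cantor_involutions" for f and P :: "bool \<Rightarrow> bool \<Rightarrow> bool"
  proof -
    have "f \<in> borel_measurable \<mu>"
      unfolding measurable_cong_sets[OF sets refl]
      by (rule borel_measurable_continuous_onI[OF continuous_cantor_involution[OF that]])
    moreover have "{x :: nat \<Rightarrow> bool. P (x 0) (x 1)} \<in> sets borel"
      by (rule borel_open[OF open_coord])
    ultimately have "measure (distr \<mu> borel f) {x. P (x 0) (x 1)} = measure \<mu> (f -` {x. P (x 0) (x 1)})"
      by (simp add: measure_distr space)
    then show ?thesis
      by (simp add: inv[OF that])
  qed
  have cyl: "measure \<mu> {x. \<not> x 0} = measure \<mu> {x. x 0 \<and> x 1 = b}" for b
  proof -
    have "swap_cylinder b -` {x. x 0 \<and> x 1 = b} = {x. \<not> x 0}"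
      by (auto simp: swap_cylinder_def)
    moreover have "swap_cylinder b \<in> cantor_involutions"
      by (cases b) (simp_all add: cantor_involutions_def)
    ultimately show ?thesis
      using preserve[of "swap_cylinder b" "\<lambda>p q. p \<and> q = b"] by simp
  qed
  have flip: "measure \<mu> {x. x 0} = measure \<mu> {x. \<not> x 0}"
  proof -
    have "flip_first -` {x. \<not> x 0} = {x. x 0}"
      by (auto simp: flip_first_def)
    then show ?thesis
      using preserve[of flip_first "\<lambda>p q. \<not> p"] by (simp add: cantor_involutions_def)
  qed
  have "measure \<mu> ({x. x 0 \<and> x 1 = True} \<union> {x. x 0 \<and> x 1 = False})
      = measure \<mu> {x. x 0 \<and> x 1 = True} + measure \<mu> {x. x 0 \<and> x 1 = False}"
    by (intro finite_measure_Union meas[of "\<lambda>p q. p \<and> q = True"] meas[of "\<lambda>p q. p \<and> q = False"]) auto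
  moreover have "{x :: nat \<Rightarrow> bool. x 0 \<and> x 1 = True} \<union> {x. x 0 \<and> x 1 = False} = {x. x 0}"
    by auto
  ultimately have zero: "measure \<mu> {x. x 0} = 0"
    using flip unfolding cyl[symmetric] by simp
  have "measure \<mu> ({x. x 0} \<union> {x. \<not> x 0}) = measure \<mu> {x. x 0} + measure \<mu> {x. \<not> x 0}"
    by (intro finite_measure_Union meas[of "\<lambda>p q. p"] meas[of "\<lambda>p q. \<not> p"]) auto
  moreover have "{x :: nat \<Rightarrow> bool. x 0} \<union> {x. \<not> x 0} = space \<mu>"
    by (auto simp: space)
  ultimately show False
    using zero flip prob_space by simp
qed

lemma compact_cantor: "compact (UNIV :: (nat \<Rightarrow> bool) set)"
proof -
  have "compact_space (euclidean :: bool topology)"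
    by (simp add: compact_space_def finite_imp_compact)
  then have "compact_space (euclidean :: (nat \<Rightarrow> bool) topology)"
    by (simp add: compact_space_product_topology flip: euclidean_product_topology)
  then show ?thesis
    by (simp add: compact_space_def)
qed

lemma Hausdorff_cantor: "Hausdorff_space (euclidean :: (nat \<Rightarrow> bool) topology)"
proof -
  have "Hausdorff_space (euclidean :: bool topology)"
    unfolding Hausdorff_space_def disjnt_def by (metis hausdorff open_openin)
  then show ?thesis
    by (simp add: Hausdorff_space_product_topology flip: euclidean_product_topology)
qed

lemma compact_transformation_group_cantor:
  "compact_transformation_group (composites cantor_involutions)"
proof -
  interpret countable_transformation_group "composites cantor_involutions"
    using cantor_involution by (intro composites_involutions) (auto simp: cantor_involutions_def)
  have "continuous_on UNIV f" if "f \<in> composites cantor_involutions" for f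
    using that
  proof induction
    case (comp f h)
    then show ?case
      using continuous_cantor_involution continuous_on_subset
      by (intro continuous_on_compose) blast+
  qed (simp add: id_def)
  then show ?thesis
    by unfold_locales (simp_all add: compact_cantor Hausdorff_cantor)
qed


section \<open>The example\<close>

text \<open>The points of the compact space are maps from \<open>\<nat>\<close> to the Cantor space, that is, double sequences of
digits. The injection \<open>\<iota>\<close> codes one by a single function on \<open>\<nat>\<close> and makes a set of sets of it by
taking singletons twice.\<close>

theorem theorem1p4:
  shows "\<exists>(G :: (nat \<Rightarrow> nat) monoid) T S \<xi>.
    Polish_group G T \<and> CB_generated G T \<and>
    word_generating_set G T S \<and> Gromov_hyperbolic (carrier G) (word_dist G S) \<and>
    \<xi> \<in> gromov_boundary (carrier G) (word_dist G S) \<one>\<^bsub>G\<^esub> \<and>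
    \<not> amenable (G\<lparr>carrier := stabilizer G (boundary_action G) \<xi>\<rparr>)
        (subtopology T (stabilizer G (boundary_action G) \<xi>))"
proof -
  interpret compact_transformation_group "composites cantor_involutions"
    by (rule compact_transformation_group_cantor)
  let ?T = "pointwise_topology G"
  define \<iota> :: "(nat \<Rightarrow> nat \<Rightarrow> bool) \<Rightarrow> (nat \<Rightarrow> nat) set set"
    where "\<iota> m = {{\<lambda>k. of_bool (case_prod m (prod_decode k))}}" for m
  have "inj \<iota>"
  proof (rule injI, intro ext)
    fix m m' i j assume "\<iota> m = \<iota> m'"
    then have "(\<lambda>k. of_bool (case_prod m (prod_decode k)) :: nat) = (\<lambda>k. of_bool (case_prod m' (prod_decode k)))"
      unfolding \<iota>_def by (simp only: singleton_inject)
    from fun_cong[OF this, of "prod_encode (i, j)"] show "m i j = m' i j"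
      by (simp split: if_splits add: of_bool_def)
  qed
  moreover have "\<nexists>\<mu>. prob_space \<mu> \<and> sets \<mu> = sets borel \<and>
      (\<forall>f\<in>composites cantor_involutions. distr \<mu> borel f = \<mu>)"
  proof clarify
    fix \<mu> :: "(nat \<Rightarrow> bool) measure"
    assume \<mu>: "prob_space \<mu>" "sets \<mu> = sets borel" "\<forall>f\<in>composites cantor_involutions. distr \<mu> borel f = \<mu>"
    have "f \<in> composites cantor_involutions" if "f \<in> cantor_involutions" for f
      using composites.comp[OF that composites.id] by simp
    with \<mu> show False
      using no_invariant_probability_cantor by blast
  qed
  ultimately have not_amen: "\<not> amenable G ?T"
    by (rule not_amenable)
  have stab: "stabilizer G (boundary_action G) upper_end = carrier G"
    by (rule stabilizer_upper_end)
  have Polish: "Polish_group G ?T"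
    unfolding G_def by (rule Polish_group_sym_centralizer)
  then interpret Polish: Polish_group G ?T .
  have "\<not> amenable (G\<lparr>carrier := stabilizer G (boundary_action G) upper_end\<rparr>)
        (subtopology ?T (stabilizer G (boundary_action G) upper_end))"
    unfolding stab using not_amen subtopology_topspace[of ?T] by (simp add: Polish.topspace_eq)
  moreover have "word_generating_set G ?T gens"
    by (rule word_generating_set_gens)
  moreover from this have "CB_generated G ?T"
    by (auto simp: CB_generated_def word_generating_set_def)
  ultimately show ?thesis
    using Polish hyperbolic upper_end_in_boundary[OF upper_end_nonempty] by blast
qed

end
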